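(* Suppose that the Bayesian game described in the context satisfies Assumptions A and B stated there. Then, for each $i\in N$, the optimal response function $\mathcal A_i^*(f_{-i},\cdot)\in\mathcal F_i$ is blockwise Lipschitz continuous in $f_{-i}$ with moduli $\{\tau_{ij}/\sigma_i\}_{j\ne i}$, in the following sense: (i) for any $p\in[1,+\infty]$, $$\|\mathcal A_i^*(f_{-i},\cdot)-\mathcal A_i^*(g_{-i},\cdot)\|_{\mathcal L^p(\eta_i)}\le\sum_{j\ne i}\frac{\tau_{ij}}{\sigma_i}\|f_j-g_j\|_{\mathcal L^p(\eta_j)},\quad\forall f_{-i},g_{-i}\in\mathcal F_{-i};$$ (ii) under the infinity norm, $$\|\mathcal A_i^*(f_{-i},\cdot)-\mathcal A_i^*(g_{-i},\cdot)\|_\infty\le\sum_{j\ne i}\frac{\tau_{ij}}{\sigma_i}\|f_j-g_j\|_\infty,\quad\forall f_{-i},g_{-i}\in\mathcal F_{-i}.$$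
   Context: Bayesian game. $N=\{1,\dots,n\}$ is the set of players. For $i\in N$, the type set $\Theta_i\subset\mathbb R^{d_i}$ and the action set $\mathcal A_i\subset\mathbb R^{z_i}$ are non-empty, compact and convex. $\Theta=\prod_i\Theta_i$, $\mathcal A=\prod_i\mathcal A_i$, and the subscript $-i$ denotes the product/vector over all players except $i$. Player $i$'s utility is $u_i(a_i,a_{-i},\theta)$, $a=(a_i,a_{-i})\in\mathcal A$, $\theta=(\theta_i,\theta_{-i})\in\Theta$. The type profile $\theta$ has a prior distribution $\eta$, a Borel probability measure on $\Theta$ with full support; $\eta_i$ denotes its marginal on $\Theta_i$, and $\eta_i(\cdot\mid\theta_i)$ the conditional distribution of $\theta_{-i}$ given $\theta_i$, a probability measure on $\Theta_{-i}$ specified for every $\theta_i\in\Theta_i$. Norms of vectors are Euclidean. Strategies. $\mathcal F_i$ is the set of measurable functions $f_i:\Theta_i\to\mathcal A_i$; $\mathcal F_{-i}=\prod_{j\neq i}\mathcal F_j$. The expected utility is $\phi_i(a_i,f_{-i},\theta_i)=\int_{\Theta_{-i}}u_i(a_i,f_{-i}(\theta_{-i}),\theta_i,\theta_{-i})\,d\eta_i(\theta_{-i}\mid\theta_i)$, and $\mathcal A_i^*(f_{-i},\theta_i):=\arg\max_{a_i\in\mathcal A_i}\phi_i(a_i,f_{-i},\theta_i)$, which is a single point under the assumptions below. Assumption A. For each $i\in N$: (a) $u_i(a,\theta)$ is continuous in $(a,\theta)$, and $\nabla_{a_i}u_i(a,\theta)$ is continuous in $a$ and measurable in $\theta$; (b)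 for each $\hat a_i\in\mathcal A_i$, $f_{-i}\in\mathcal F_{-i}$ and $\theta_i\in\Theta_i$ there exist a neighborhood $\mathcal U_i(\hat a_i;f_{-i},\theta_i)$ of $\hat a_i$ relative to $\mathcal A_i$ and a nonnegative function $h_{\hat a_i,f_{-i}}:\Theta_i\times\Theta_{-i}\to\mathbb R_+$ with $h_{\hat a_i,f_{-i}}(\theta_i,\cdot)\in\mathcal L^1(\eta_i(\cdot\mid\theta_i))$ such that $\sup_{a_i\in\mathcal U_i(\hat a_i;f_{-i},\theta_i)}\|\nabla_{a_i}u_i(a_i,f_{-i}(\theta_{-i}),\theta_i,\theta_{-i})\|\le h_{\hat a_i,f_{-i}}(\theta_i,\theta_{-i})$ for all $\theta_{-i}\in\Theta_{-i}$ (the function $h_{\hat a_i,f_{-i}}$ depends only on $\hat a_i,f_{-i}$, the neighborhood may depend on $\theta_i$ too); (c) for every Borel set $S\subset\Theta_{-i}$, $\eta_i(S\mid\cdot)$ is measurable on $\Theta_i$. Assumption B. For each $i\in N$: (a) there is a constant $\sigma_i>0$ such that $(\nabla_{a_i}u_i(a_i',a_{-i},\theta)-\nabla_{a_i}u_i(a_i'',a_{-i},\theta))^\top(a_i'-a_i'')\le-\sigma_i\|a_i'-a_i''\|^2$ for all $a_i',a_i''\in\mathcal A_i$, $a_{-i}\in\mathcal A_{-i}$, $\theta\in\Theta$; (b) there are constants $\tau_{ij}\ge 0$, $j\ne i$, such that $\|\nabla_{a_i}u_i(a_i,a_{-i}',\theta)-\nabla_{a_i}u_i(a_i,a_{-i}'',\theta)\|\le\sum_{j\ne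 i}\tau_{ij}\|a_j'-a_j''\|$ for all $a_{-i}',a_{-i}''\in\mathcal A_{-i}$, $a_i\in\mathcal A_i$, $\theta\in\Theta$. Norms. $\|f_i\|_{\mathcal L^p(\eta_i)}=(\int_{\Theta_i}\|f_i\|^p\,d\eta_i)^{1/p}$ for $p<\infty$, the $\eta_i$-essential supremum of $\|f_i(\cdot)\|$ for $p=\infty$; $\|f_i\|_\infty=\sup_{\theta_i\in\Theta_i}\|f_i(\theta_i)\|$. *)

theory Defs
  imports "HOL-Probability.Probability"
begin

(* The Euclidean spaces R^(d_i) and R^(z_i), whose dimensions depend on the player, are linear
   subspaces tspace i, aspace i of common ambient Euclidean spaces 'd and 'z (any finite family of
   Euclidean spaces embeds isometrically in this way).  Profiles are functions on the players that
   are undefined off their index set (PiE), so that a profile of all players is obtained from the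
   pair (x_i, x_(-i)) as x_(-i)(i := x_i).  Topologies and Borel sigma-algebras on sets of profiles
   are those induced by the product topology of the function space. *)
record ('d, 'z) bayesian_game =
  nplayers :: nat
  tspace :: "nat \<Rightarrow> 'd set"
  aspace :: "nat \<Rightarrow> 'z set"
  types :: "nat \<Rightarrow> 'd set"
  actions :: "nat \<Rightarrow> 'z set"
  utility :: "nat \<Rightarrow> (nat \<Rightarrow> 'z) \<Rightarrow> (nat \<Rightarrow> 'd) \<Rightarrow> real"
  prior :: "(nat \<Rightarrow> 'd) measure"
  conditional :: "nat \<Rightarrow> 'd \<Rightarrow> (nat \<Rightarrow> 'd) measure"

definition players :: "('d, 'z, 'm) bayesian_game_scheme \<Rightarrow> nat set" where
  "players G = {1..nplayers G}"

definition others :: "('d, 'z, 'm) bayesian_game_scheme \<Rightarrow> nat \<Rightarrow> nat set" where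
  "others G i = players G - {i}"

definition type_profiles :: "('d, 'z, 'm) bayesian_game_scheme \<Rightarrow> (nat \<Rightarrow> 'd) set" where
  "type_profiles G = (\<Pi>\<^sub>E i\<in>players G. types G i)"

definition action_profiles :: "('d, 'z, 'm) bayesian_game_scheme \<Rightarrow> (nat \<Rightarrow> 'z) set" where
  "action_profiles G = (\<Pi>\<^sub>E i\<in>players G. actions G i)"

definition others_types :: "('d, 'z, 'm) bayesian_game_scheme \<Rightarrow> nat \<Rightarrow> (nat \<Rightarrow> 'd) set" where
  "others_types G i = (\<Pi>\<^sub>E j\<in>others G i. types G j)"

definition others_actions :: "('d, 'z, 'm) bayesian_game_scheme \<Rightarrow> nat \<Rightarrow> (nat \<Rightarrow> 'z) set" where
  "others_actions G i = (\<Pi>\<^sub>E j\<in>others G i. actions G j)"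

definition marginal ::
  "('d::euclidean_space, 'z, 'm) bayesian_game_scheme \<Rightarrow> nat \<Rightarrow> 'd measure" where
  "marginal G i = distr (prior G) (restrict_space borel (types G i)) (\<lambda>\<theta>. \<theta> i)"

(* The defining property of the conditional distributions is the disintegration of the prior; the
   measurability of their values in the own type is part of Assumption A. *)
definition is_conditional ::
  "('d::euclidean_space, 'z, 'm) bayesian_game_scheme \<Rightarrow> nat \<Rightarrow> bool" where
  "is_conditional G i \<longleftrightarrow>
     (\<forall>t\<in>types G i. prob_space (conditional G i t) \<and>
        sets (conditional G i t) = sets (restrict_space borel (others_types G i))) \<and>
     (\<forall>B\<in>sets (restrict_space borel (types G i)).
      \<forall>S\<in>sets (restrict_space borel (others_types G i)).
        emeasure (prior G) {\<theta>\<in>type_profiles G. \<theta> i \<in> B \<and> restrict \<theta> (others G i) \<in> S} =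
        (\<integral>\<^sup>+ t\<in>B. emeasure (conditional G i t) S \<partial>marginal G i))"

definition is_bayesian_game ::
  "('d::euclidean_space, 'z::euclidean_space, 'm) bayesian_game_scheme \<Rightarrow> bool" where
  "is_bayesian_game G \<longleftrightarrow>
     (\<forall>i\<in>players G.
        subspace (tspace G i) \<and> types G i \<subseteq> tspace G i \<and>
        types G i \<noteq> {} \<and> compact (types G i) \<and> convex (types G i) \<and>
        subspace (aspace G i) \<and> actions G i \<subseteq> aspace G i \<and>
        actions G i \<noteq> {} \<and> compact (actions G i) \<and> convex (actions G i)) \<and>
     prob_space (prior G) \<and>
     sets (prior G) = sets (restrict_space borel (type_profiles G)) \<and>
     (\<forall>U. openin (top_of_set (type_profiles G)) U \<and> U \<noteq> {} \<longrightarrow> emeasure (prior G) U > 0) \<and>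
     (\<forall>i\<in>players G. is_conditional G i)"

definition strategies ::
  "('d::euclidean_space, 'z::euclidean_space, 'm) bayesian_game_scheme \<Rightarrow> nat \<Rightarrow> ('d \<Rightarrow> 'z) set" where
  "strategies G i =
     measurable (restrict_space borel (types G i)) (restrict_space borel (actions G i))"

definition others_strategies ::
  "('d::euclidean_space, 'z::euclidean_space, 'm) bayesian_game_scheme
     \<Rightarrow> nat \<Rightarrow> (nat \<Rightarrow> 'd \<Rightarrow> 'z) set" where
  "others_strategies G i = (\<Pi> j\<in>others G i. strategies G j)"

definition play ::
  "('d, 'z, 'm) bayesian_game_scheme \<Rightarrow> nat \<Rightarrow> (nat \<Rightarrow> 'd \<Rightarrow> 'z) \<Rightarrow> (nat \<Rightarrow> 'd) \<Rightarrow> (nat \<Rightarrow> 'z)" where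
  "play G i f s = (\<lambda>j\<in>others G i. f j (s j))"

definition expected_utility ::
  "('d, 'z, 'm) bayesian_game_scheme \<Rightarrow> nat \<Rightarrow> 'z \<Rightarrow> (nat \<Rightarrow> 'd \<Rightarrow> 'z) \<Rightarrow> 'd \<Rightarrow> real" where
  "expected_utility G i a f t =
     (\<integral>s. utility G i ((play G i f s)(i := a)) (s(i := t)) \<partial>conditional G i t)"

definition optimal_responses ::
  "('d, 'z, 'm) bayesian_game_scheme \<Rightarrow> nat \<Rightarrow> (nat \<Rightarrow> 'd \<Rightarrow> 'z) \<Rightarrow> 'd \<Rightarrow> 'z set" where
  "optimal_responses G i f t =
     {a\<in>actions G i. \<forall>b\<in>actions G i. expected_utility G i b f t \<le> expected_utility G i a f t}"

definition optimal_response ::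
  "('d, 'z, 'm) bayesian_game_scheme \<Rightarrow> nat \<Rightarrow> (nat \<Rightarrow> 'd \<Rightarrow> 'z) \<Rightarrow> 'd \<Rightarrow> 'z" where
  "optimal_response G i f t = the_elem (optimal_responses G i f t)"

(* grad i a \<theta> is the gradient of u_i in a_i, a vector of R^(z_i).  The action sets may have empty
   interior, so the derivative is taken within the action set; there the gradient need not be
   unique, which is why it is data rather than a function of the utility. *)
definition is_own_gradient ::
  "('d::euclidean_space, 'z::euclidean_space, 'm) bayesian_game_scheme
     \<Rightarrow> (nat \<Rightarrow> (nat \<Rightarrow> 'z) \<Rightarrow> (nat \<Rightarrow> 'd) \<Rightarrow> 'z) \<Rightarrow> bool" where
  "is_own_gradient G grad \<longleftrightarrow>
     (\<forall>i\<in>players G. \<forall>a\<in>action_profiles G. \<forall>\<theta>\<in>type_profiles G.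
        grad i a \<theta> \<in> aspace G i \<and>
        ((\<lambda>b. utility G i (a(i := b)) \<theta>) has_derivative (\<lambda>v. grad i a \<theta> \<bullet> v))
          (at (a i) within actions G i))"

definition assumption_A ::
  "('d::euclidean_space, 'z::euclidean_space, 'm) bayesian_game_scheme
     \<Rightarrow> (nat \<Rightarrow> (nat \<Rightarrow> 'z) \<Rightarrow> (nat \<Rightarrow> 'd) \<Rightarrow> 'z) \<Rightarrow> bool" where
  "assumption_A G grad \<longleftrightarrow> is_own_gradient G grad \<and>
     (\<forall>i\<in>players G.
        continuous_on (action_profiles G \<times> type_profiles G) (\<lambda>(a, \<theta>). utility G i a \<theta>) \<and>
        (\<forall>\<theta>\<in>type_profiles G. continuous_on (action_profiles G) (\<lambda>a. grad i a \<theta>)) \<and>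
        (\<forall>a\<in>action_profiles G.
           grad i a \<in> borel_measurable (restrict_space borel (type_profiles G))) \<and>
        (\<forall>c\<in>actions G i. \<forall>f\<in>others_strategies G i. \<exists>h :: 'd \<Rightarrow> (nat \<Rightarrow> 'd) \<Rightarrow> real.
           (\<forall>t\<in>types G i. \<forall>s\<in>others_types G i. 0 \<le> h t s) \<and>
           (\<forall>t\<in>types G i. integrable (conditional G i t) (h t) \<and>
              (\<exists>U. openin (top_of_set (actions G i)) U \<and> c \<in> U \<and>
                 (\<forall>a\<in>U. \<forall>s\<in>others_types G i.
                    norm (grad i ((play G i f s)(i := a)) (s(i := t))) \<le> h t s)))) \<and>
        (\<forall>S\<in>sets (restrict_space borel (others_types G i)).
           (\<lambda>t. emeasure (conditional G i t) S)
             \<in> borel_measurable (restrict_space borel (types G i))))"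

definition assumption_B ::
  "('d::euclidean_space, 'z::euclidean_space, 'm) bayesian_game_scheme
     \<Rightarrow> (nat \<Rightarrow> (nat \<Rightarrow> 'z) \<Rightarrow> (nat \<Rightarrow> 'd) \<Rightarrow> 'z)
     \<Rightarrow> (nat \<Rightarrow> real) \<Rightarrow> (nat \<Rightarrow> nat \<Rightarrow> real) \<Rightarrow> bool" where
  "assumption_B G grad \<sigma> \<tau> \<longleftrightarrow>
     (\<forall>i\<in>players G.
        \<sigma> i > 0 \<and>
        (\<forall>a'\<in>actions G i. \<forall>a''\<in>actions G i. \<forall>b\<in>others_actions G i. \<forall>\<theta>\<in>type_profiles G.
           (grad i (b(i := a')) \<theta> - grad i (b(i := a'')) \<theta>) \<bullet> (a' - a'')
             \<le> - \<sigma> i * (norm (a' - a''))\<^sup>2) \<and>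
        (\<forall>j\<in>others G i. 0 \<le> \<tau> i j) \<and>
        (\<forall>b'\<in>others_actions G i. \<forall>b''\<in>others_actions G i. \<forall>a\<in>actions G i. \<forall>\<theta>\<in>type_profiles G.
           norm (grad i (b'(i := a)) \<theta> - grad i (b''(i := a)) \<theta>)
             \<le> (\<Sum>j\<in>others G i. \<tau> i j * norm (b' j - b'' j))))"

(* Both norms are meant for bounded functions (with f measurable in the first case), such as
   differences of strategies; being real-valued, they say nothing when the true norm is infinite. *)
definition Lp_norm ::
  "ennreal \<Rightarrow> 'a measure \<Rightarrow> ('a \<Rightarrow> 'b::real_normed_vector) \<Rightarrow> real" where
  "Lp_norm p M f =
     (if p = \<infinity> then enn2real (esssup M (\<lambda>x. ennreal (norm (f x))))
      else (\<integral>x. norm (f x) powr enn2real p \<partial>M) powr (1 / enn2real p))"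

definition sup_norm :: "'a set \<Rightarrow> ('a \<Rightarrow> 'b::real_normed_vector) \<Rightarrow> real" where
  "sup_norm S f = (SUP x\<in>S. norm (f x))"

end

theory Submission
  imports Defs
begin

text \<open>
Fix a player \<open>i\<close> and an own type \<open>t\<close>. For every type profile of the others, the utility is strongly
concave in the own action with modulus \<open>\<sigma> i\<close>, since its gradient is strongly monotone
(\<open>strongly_concave_onI_gradient\<close>). Written as an inequality along segments, this property survives
integration over the belief of type \<open>t\<close>, so the expected utility is strongly concave; it is also
continuous, hence has exactly one maximizer on the compact convex action set. As \<open>t\<close> varies, this
maximizer is measurable because the expected utility is continuous in the action and measurable in
the type (\<open>the_argmax_on_measurable\<close>).

A strongly concave function lies below its maximum by at least \<open>\<sigma> / 2\<close> times the squared distance to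
the maximizer. Applying this to the expected utilities against \<open>f\<close> and \<open>g\<close>, each evaluated at the
maximizer of the other, bounds \<open>\<sigma>\<close> times the distance of the two maximizers by the Lipschitz constant
of the difference of the two expected utilities (\<open>argmax_on_strongly_concave_stable\<close>). The gradient
of the difference of the realized utilities is controlled by the cross-Lipschitz condition, whence

  \<open>\<parallel>f* t - g* t\<parallel> \<le> \<integral>s. (\<Sum>j. \<tau> i j / \<sigma> i * \<parallel>f j (s j) - g j (s j)\<parallel>) \<partial>(belief of t)\<close>

for every \<open>t\<close>, where \<open>f*\<close> and \<open>g*\<close> are the optimal responses
(\<open>optimal_response_interim_estimate\<close>). Bounding the integrand by suprema gives the estimate in the
supremum norm.

For the Lebesgue norms, the beliefs mixed by the marginal law of the own type give back the prior law
of the types of the others (\<open>marginal_bind_belief\<close>). Averaging under a kernel does not increase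
Lebesgue norms when the target norm is taken under the mixture (\<open>Lp_norm_kernel_mean_le\<close>), and under
the mixture the norm of a function of \<open>s j\<close> is its norm under the marginal law of player \<open>j\<close>.
\<close>

section \<open>Strongly concave functions\<close>

text \<open>The inequality along segments, without any gradient, so that it can be integrated pointwise.\<close>

definition strongly_concave_on :: "'a::real_inner set \<Rightarrow> real \<Rightarrow> ('a \<Rightarrow> real) \<Rightarrow> bool" where
  "strongly_concave_on S \<sigma> F \<longleftrightarrow> (\<forall>a\<in>S. \<forall>b\<in>S. \<forall>x\<in>{0..1}.
     (1 - x) * F a + x * F b + \<sigma> / 2 * x * (1 - x) * (norm (a - b))\<^sup>2
       \<le> F ((1 - x) *\<^sub>R a + x *\<^sub>R b))"

text \<open>Along the segment from \<open>z\<close> to \<open>a\<close>, the difference of \<open>F\<close> and the right-hand side has a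
nonpositive derivative, by strong monotonicity of the gradient.\<close>

lemma strongly_monotone_gradient_imp_upper_bound:
  fixes S :: "'a::euclidean_space set" and D :: "'a \<Rightarrow> 'a"
  assumes "convex S"
    and deriv: "\<And>a. a \<in> S \<Longrightarrow> (F has_derivative (\<lambda>v. D a \<bullet> v)) (at a within S)"
    and mono: "\<And>a b. a \<in> S \<Longrightarrow> b \<in> S \<Longrightarrow> (D a - D b) \<bullet> (a - b) \<le> - \<sigma> * (norm (a - b))\<^sup>2"
    and a: "a \<in> S" and z: "z \<in> S"
  shows "F a \<le> F z + D z \<bullet> (a - z) - \<sigma> / 2 * (norm (a - z))\<^sup>2"
proof -
  define c where "c x = z + x *\<^sub>R (a - z)" for x :: real
  define \<psi> where "\<psi> x = F (c x) - x * (D z \<bullet> (a - z)) + \<sigma> / 2 * x\<^sup>2 * (norm (a - z))\<^sup>2" for x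
  have c_mem: "c x \<in> S" if "0 \<le> x" "x \<le> 1" for x
    using convexD_alt[OF \<open>convex S\<close> z a that] by (simp add: c_def algebra_simps)
  have der: "(\<psi> has_derivative (\<lambda>h. h * (D (c x) \<bullet> (a - z) - D z \<bullet> (a - z) + \<sigma> * x * (norm (a - z))\<^sup>2)))
      (at x within {0..1})" if x: "0 \<le> x" "x \<le> 1" for x
  proof -
    have 1: "(c has_derivative (\<lambda>h. h *\<^sub>R (a - z))) (at x within {0..1})"
      unfolding c_def by (auto intro!: derivative_eq_intros)
    have 2: "(F has_derivative (\<lambda>v. D (c x) \<bullet> v)) (at (c x) within c ` {0..1})"
      by (rule has_derivative_subset[OF deriv[OF c_mem[OF x]]]) (auto intro: c_mem)
    have 3: "((\<lambda>x. F (c x)) has_derivative (\<lambda>h. D (c x) \<bullet> (h *\<^sub>R (a - z)))) (at x within {0..1})"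
      using has_derivative_in_compose[OF 1 2] by simp
    show ?thesis unfolding \<psi>_def
      by (auto intro!: derivative_eq_intros 3 simp: algebra_simps power2_eq_square)
  qed
  obtain x where x: "0 \<le> x" "x \<le> 1"
    and eq: "\<psi> 1 - \<psi> 0 = (1 - 0) * (D (c x) \<bullet> (a - z) - D z \<bullet> (a - z) + \<sigma> * x * (norm (a - z))\<^sup>2)"
    using mvt_very_simple[of 0 1 \<psi>, OF _ der] by auto
  have "D (c x) \<bullet> (a - z) - D z \<bullet> (a - z) + \<sigma> * x * (norm (a - z))\<^sup>2 \<le> 0"
  proof (cases "x = 0")
    case True then show ?thesis by (simp add: c_def)
  next
    case False
    with x have "x > 0" by simp
    have "(D (c x) - D z) \<bullet> (c x - z) \<le> - \<sigma> * (norm (c x - z))\<^sup>2"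
      by (rule mono[OF c_mem[OF x] z])
    then have "x * ((D (c x) - D z) \<bullet> (a - z)) \<le> x * (- \<sigma> * x * (norm (a - z))\<^sup>2)"
      by (simp add: c_def power_mult_distrib power2_eq_square mult_ac)
    then have "(D (c x) - D z) \<bullet> (a - z) \<le> - \<sigma> * x * (norm (a - z))\<^sup>2"
      using \<open>x > 0\<close> by (simp only: mult_le_cancel_left_pos)
    then show ?thesis by (simp add: inner_diff_left)
  qed
  with eq have "\<psi> 1 \<le> \<psi> 0" by simp
  then show ?thesis by (simp add: \<psi>_def c_def)
qed

text \<open>The two upper bounds based at the intermediate point \<open>z = (1 - x) a + x b\<close> are combined with the
weights \<open>1 - x\<close> and \<open>x\<close>; the terms linear in the gradient at \<open>z\<close> cancel.\<close>

lemma strongly_concave_onI_gradient: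
  fixes S :: "'a::euclidean_space set" and D :: "'a \<Rightarrow> 'a"
  assumes "convex S"
    and "\<And>a. a \<in> S \<Longrightarrow> (F has_derivative (\<lambda>v. D a \<bullet> v)) (at a within S)"
    and "\<And>a b. a \<in> S \<Longrightarrow> b \<in> S \<Longrightarrow> (D a - D b) \<bullet> (a - b) \<le> - \<sigma> * (norm (a - b))\<^sup>2"
  shows "strongly_concave_on S \<sigma> F"
  unfolding strongly_concave_on_def
proof (intro ballI)
  fix a b :: 'a and x :: real
  assume a: "a \<in> S" and b: "b \<in> S" and x: "x \<in> {0..1}"
  define z where "z = (1 - x) *\<^sub>R a + x *\<^sub>R b"
  have z: "z \<in> S" using convexD_alt[OF \<open>convex S\<close> a b] x by (simp add: z_def)
  have ub: "F c \<le> F z + D z \<bullet> (c - z) - \<sigma> / 2 * (norm (c - z))\<^sup>2" if "c \<in> S" for c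
    by (rule strongly_monotone_gradient_imp_upper_bound[of S F D \<sigma> c z])
      (use assms that z in blast)+
  have az: "a - z = x *\<^sub>R (a - b)" and bz: "b - z = (x - 1) *\<^sub>R (a - b)"
    by (simp_all add: z_def algebra_simps)
  define E where "E = D z \<bullet> (a - b)"
  define q where "q = (norm (a - b))\<^sup>2"
  have 1: "F a \<le> F z + x * E - \<sigma> / 2 * (x\<^sup>2 * q)"
    using ub[OF a] by (simp add: az E_def q_def power_mult_distrib)
  have 2: "F b \<le> F z + (x - 1) * E - \<sigma> / 2 * ((x - 1)\<^sup>2 * q)"
    using ub[OF b] by (simp add: bz E_def q_def power_mult_distrib)
  have "(1 - x) * F a + x * F b \<le> (1 - x) * (F z + x * E - \<sigma> / 2 * (x\<^sup>2 * q))
      + x * (F z + (x - 1) * E - \<sigma> / 2 * ((x - 1)\<^sup>2 * q))"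
    using x by (intro add_mono mult_left_mono 1 2) auto
  also have "\<dots> = F z - \<sigma> / 2 * x * (1 - x) * q"
    by (simp add: field_simps power2_eq_square)
  finally show "(1 - x) * F a + x * F b + \<sigma> / 2 * x * (1 - x) * (norm (a - b))\<^sup>2
      \<le> F ((1 - x) *\<^sub>R a + x *\<^sub>R b)"
    by (simp add: z_def q_def)
qed

lemma strongly_concave_on_integral:
  fixes S :: "'a::real_inner set" and F :: "'a \<Rightarrow> 's \<Rightarrow> real"
  assumes "prob_space M" and "convex S"
    and conc: "\<And>s. s \<in> space M \<Longrightarrow> strongly_concave_on S \<sigma> (\<lambda>a. F a s)"
    and int: "\<And>a. a \<in> S \<Longrightarrow> integrable M (F a)"
  shows "strongly_concave_on S \<sigma> (\<lambda>a. \<integral>s. F a s \<partial>M)"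
  unfolding strongly_concave_on_def
proof (intro ballI)
  interpret prob_space M by fact
  fix a b :: 'a and x :: real
  assume a: "a \<in> S" and b: "b \<in> S" and x: "x \<in> {0..1}"
  have z: "(1 - x) *\<^sub>R a + x *\<^sub>R b \<in> S"
    using convexD_alt[OF \<open>convex S\<close> a b] x by simp
  have "(1 - x) * (\<integral>s. F a s \<partial>M) + x * (\<integral>s. F b s \<partial>M) + \<sigma> / 2 * x * (1 - x) * (norm (a - b))\<^sup>2
      = (\<integral>s. (1 - x) * F a s + x * F b s + \<sigma> / 2 * x * (1 - x) * (norm (a - b))\<^sup>2 \<partial>M)"
    using int[OF a] int[OF b] by (simp add: prob_space)
  also have "\<dots> \<le> (\<integral>s. F ((1 - x) *\<^sub>R a + x *\<^sub>R b) s \<partial>M)"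
    using conc a b x int[OF a] int[OF b] int[OF z]
    by (intro integral_mono) (auto simp: strongly_concave_on_def)
  finally show "(1 - x) * (\<integral>s. F a s \<partial>M) + x * (\<integral>s. F b s \<partial>M)
      + \<sigma> / 2 * x * (1 - x) * (norm (a - b))\<^sup>2 \<le> (\<integral>s. F ((1 - x) *\<^sub>R a + x *\<^sub>R b) s \<partial>M)" .
qed

definition argmax_on :: "'a set \<Rightarrow> ('a \<Rightarrow> real) \<Rightarrow> 'a set" where
  "argmax_on S F = {a\<in>S. \<forall>b\<in>S. F b \<le> F a}"

text \<open>Strong concavity on the segment from \<open>a\<close> to \<open>b\<close>, together with maximality of \<open>a\<close> at the point of
parameter \<open>x\<close>, gives the claim with the extra factor \<open>1 - x\<close>, and then \<open>x\<close> tends to \<open>0\<close>.\<close>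

lemma strongly_concave_on_quadratic_growth:
  assumes conc: "strongly_concave_on S \<sigma> F" and "convex S"
    and a: "a \<in> argmax_on S F" and b: "b \<in> S"
  shows "F b + \<sigma> / 2 * (norm (a - b))\<^sup>2 \<le> F a"
proof -
  have aS: "a \<in> S" using a by (simp add: argmax_on_def)
  have le: "F b + \<sigma> / 2 * (1 - x) * (norm (a - b))\<^sup>2 \<le> F a" if x: "x \<in> {0<..<1}" for x :: real
  proof -
    have "(1 - x) *\<^sub>R a + x *\<^sub>R b \<in> S"
      using convexD_alt[OF \<open>convex S\<close> aS b] x by simp
    then have "F ((1 - x) *\<^sub>R a + x *\<^sub>R b) \<le> F a"
      using a by (simp add: argmax_on_def)
    moreover have "(1 - x) * F a + x * F b + \<sigma> / 2 * x * (1 - x) * (norm (a - b))\<^sup>2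
        \<le> F ((1 - x) *\<^sub>R a + x *\<^sub>R b)"
      using conc aS b x by (simp add: strongly_concave_on_def)
    ultimately have "x * (F b + \<sigma> / 2 * (1 - x) * (norm (a - b))\<^sup>2) \<le> x * F a"
      by (simp add: algebra_simps)
    then show ?thesis using x by simp
  qed
  have "((\<lambda>x. F b + \<sigma> / 2 * (1 - x) * (norm (a - b))\<^sup>2) \<longlongrightarrow> F b + \<sigma> / 2 * (1 - 0) * (norm (a - b))\<^sup>2)
      (at_right 0)"
    by (intro tendsto_intros)
  moreover have "\<forall>\<^sub>F x in at_right 0. F b + \<sigma> / 2 * (1 - x) * (norm (a - b))\<^sup>2 \<le> F a"
    unfolding eventually_at_right_field using le by (intro exI[of _ 1]) auto
  ultimately have "F b + \<sigma> / 2 * (1 - 0) * (norm (a - b))\<^sup>2 \<le> F a"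
    by (rule tendsto_upperbound) simp
  then show ?thesis by simp
qed

text \<open>Quadratic growth of \<open>F\<close> at \<open>a\<close> and of \<open>H\<close> at \<open>b\<close> adds up to \<open>\<sigma> \<parallel>a - b\<parallel>\<^sup>2\<close>, one half from each function,
while only the increment of \<open>F - H\<close> remains on the other side.\<close>

lemma argmax_on_strongly_concave_stable:
  assumes "strongly_concave_on S \<sigma> F" "strongly_concave_on S \<sigma> H" "convex S" "0 < \<sigma>" "0 \<le> L"
    and a: "a \<in> argmax_on S F" and b: "b \<in> argmax_on S H"
    and lip: "(F a - H a) - (F b - H b) \<le> L * norm (a - b)"
  shows "norm (a - b) \<le> L / \<sigma>"
proof (cases "a = b")
  case True then show ?thesis using assms by simp
next
  case False
  have "a \<in> S" "b \<in> S" using a b by (auto simp: argmax_on_def)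
  have "F b + \<sigma> / 2 * (norm (a - b))\<^sup>2 \<le> F a"
    by (rule strongly_concave_on_quadratic_growth) fact+
  moreover have "H a + \<sigma> / 2 * (norm (b - a))\<^sup>2 \<le> H b"
    by (rule strongly_concave_on_quadratic_growth) fact+
  ultimately have "\<sigma> * (norm (a - b))\<^sup>2 \<le> L * norm (a - b)"
    using lip by (simp add: norm_minus_commute)
  then have "\<sigma> * norm (a - b) \<le> L"
    using False by (simp add: power2_eq_square)
  then show ?thesis using \<open>0 < \<sigma>\<close> by (simp add: field_simps)
qed

lemma strongly_concave_on_argmax_singleton:
  fixes S :: "'a::real_inner set"
  assumes "strongly_concave_on S \<sigma> F" "convex S" "0 < \<sigma>"
    and "compact S" "S \<noteq> {}" "continuous_on S F"
  shows "\<exists>a. argmax_on S F = {a}"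
proof -
  obtain a where a: "a \<in> argmax_on S F"
    using continuous_attains_sup[of S F] assms by (auto simp: argmax_on_def)
  have "b = a" if "b \<in> argmax_on S F" for b
    using argmax_on_strongly_concave_stable[of S \<sigma> F F 0 b a] assms a that by simp
  with a show ?thesis by blast
qed

section \<open>Measurability of a unique maximizer\<close>

text \<open>The maximizer \<open>r t\<close> lies in a closed set \<open>C\<close> exactly if \<open>\<Phi> t\<close> has the same supremum over \<open>C \<inter> S\<close> as
over \<open>S\<close>: by compactness the supremum over \<open>C \<inter> S\<close> is attained, and an attained maximum must be
\<open>r t\<close>. By continuity, both suprema may be taken over countable dense subsets, which turns the
condition into countably many measurable ones.\<close>

lemma the_argmax_on_measurable:
  fixes S :: "'a::{euclidean_space} set" and \<Phi> :: "'t \<Rightarrow> 'a \<Rightarrow> real"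
  assumes S: "compact S"
    and cont: "\<And>t. t \<in> space M \<Longrightarrow> continuous_on S (\<Phi> t)"
    and meas: "\<And>a. a \<in> S \<Longrightarrow> (\<lambda>t. \<Phi> t a) \<in> borel_measurable M"
    and uniq: "\<And>t. t \<in> space M \<Longrightarrow> argmax_on S (\<Phi> t) = {r t}"
  shows "r \<in> measurable M (restrict_space borel S)"
proof (rule measurable_restrict_space2)
  have rS: "r t \<in> S" if "t \<in> space M" for t
    using uniq[OF that] by (auto simp: argmax_on_def)
  then show "r \<in> space M \<rightarrow> S" by auto
  obtain D where D: "countable D" "D \<subseteq> S" "S \<subseteq> closure D" using separable[of S] by auto
  show "r \<in> borel_measurable M"
    unfolding borel_eq_closed
  proof (rule measurable_measure_of)
    fix C :: "'a set" assume "C \<in> Collect closed"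
    then have C: "closed C" by simp
    obtain B where B: "countable B" "B \<subseteq> C \<inter> S" "C \<inter> S \<subseteq> closure B"
      using separable[of "C \<inter> S"] by auto
    have "r t \<in> C \<longleftrightarrow> (\<forall>n::nat. \<exists>c\<in>B. \<forall>d\<in>D. \<Phi> t d - 1 / Suc n \<le> \<Phi> t c)"
      if t: "t \<in> space M" for t
    proof
      assume rC: "r t \<in> C"
      show "\<forall>n::nat. \<exists>c\<in>B. \<forall>d\<in>D. \<Phi> t d - 1 / Suc n \<le> \<Phi> t c"
      proof
        fix n :: nat
        have "0 < 1 / real (Suc n)" by simp
        then obtain \<delta> where \<delta>: "\<delta> > 0"
          "\<And>c. c \<in> S \<Longrightarrow> dist c (r t) < \<delta> \<Longrightarrow> dist (\<Phi> t c) (\<Phi> t (r t)) < 1 / Suc n"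
          using cont[OF t] rS[OF t] unfolding continuous_on_iff by blast
        obtain c where c: "c \<in> B" "dist c (r t) < \<delta>"
          using B(3) rC rS[OF t] \<delta>(1) closure_approachable[of "r t" B] by blast
        then have "dist (\<Phi> t c) (\<Phi> t (r t)) < 1 / Suc n" using \<delta>(2) B(2) by blast
        moreover have "\<Phi> t d \<le> \<Phi> t (r t)" if "d \<in> D" for d
          using uniq[OF t] that D(2) by (auto simp: argmax_on_def)
        ultimately have "\<forall>d\<in>D. \<Phi> t d - 1 / Suc n \<le> \<Phi> t c"
          by (fastforce simp: dist_real_def)
        with c(1) show "\<exists>c\<in>B. \<forall>d\<in>D. \<Phi> t d - 1 / Suc n \<le> \<Phi> t c" by blast
      qed
    next
      assume *: "\<forall>n::nat. \<exists>c\<in>B. \<forall>d\<in>D. \<Phi> t d - 1 / Suc n \<le> \<Phi> t c"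
      then have "C \<inter> S \<noteq> {}" using B(2) by blast
      moreover have "compact (C \<inter> S)" using C S by (simp add: closed_Int_compact)
      moreover have "continuous_on (C \<inter> S) (\<Phi> t)"
        using cont[OF t] by (rule continuous_on_subset) auto
      ultimately obtain c0 where c0: "c0 \<in> C" "c0 \<in> S" "\<And>c. c \<in> C \<inter> S \<Longrightarrow> \<Phi> t c \<le> \<Phi> t c0"
        using continuous_attains_sup[of "C \<inter> S" "\<Phi> t"] by auto
      have D_le: "\<Phi> t d \<le> \<Phi> t c0" if d: "d \<in> D" for d
      proof (rule field_le_epsilon)
        fix e :: real assume "e > 0"
        then obtain n where n: "1 / Suc n < e"
          using nat_approx_posE by blast
        obtain c where c: "c \<in> B" "\<Phi> t d - 1 / Suc n \<le> \<Phi> t c" using * d by blast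
        then have "\<Phi> t c \<le> \<Phi> t c0" using B(2) by (intro c0(3)) auto
        with c(2) n show "\<Phi> t d \<le> \<Phi> t c0 + e" by linarith
      qed
      have "\<Phi> t a \<le> \<Phi> t c0" if a: "a \<in> S" for a
      proof (rule field_le_epsilon)
        fix e :: real assume "e > 0"
        then obtain \<delta> where \<delta>: "\<delta> > 0" "\<And>c. c \<in> S \<Longrightarrow> dist c a < \<delta> \<Longrightarrow> dist (\<Phi> t c) (\<Phi> t a) < e"
          using cont[OF t] a unfolding continuous_on_iff by blast
        obtain d where d: "d \<in> D" "dist d a < \<delta>"
          using D(3) a \<delta>(1) closure_approachable[of a D] by blast
        then have "dist (\<Phi> t d) (\<Phi> t a) < e" using \<delta>(2) D(2) by blast
        with D_le[OF d(1)] show "\<Phi> t a \<le> \<Phi> t c0 + e" by (simp add: dist_real_def)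
      qed
      with c0 have "c0 \<in> argmax_on S (\<Phi> t)" by (simp add: argmax_on_def)
      with uniq[OF t] c0 show "r t \<in> C" by simp
    qed
    then have "r -` C \<inter> space M =
        {t \<in> space M. \<forall>n::nat. \<exists>c\<in>B. \<forall>d\<in>D. \<Phi> t d - 1 / Suc n \<le> \<Phi> t c}"
      by auto
    also have "\<dots> \<in> sets M"
    proof -
      have [measurable]: "(\<lambda>t. \<Phi> t c) \<in> borel_measurable M" if "c \<in> B" for c
        using that B(2) by (intro meas) auto
      have [measurable]: "(\<lambda>t. \<Phi> t d) \<in> borel_measurable M" if "d \<in> D" for d
        using that D(2) by (intro meas) auto
      show ?thesis
        by (intro sets.sets_Collect_countable_All sets.sets_Collect_countable_Ex'
            sets.sets_Collect_countable_All' sets.sets_Collect_countable_Ball sets.sets_Collect_countable_Bex B D)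
          measurable
    qed
    finally show "r -` C \<inter> space M \<in> sets M" .
  qed auto
qed

section \<open>Averages in Lebesgue norms\<close>

lemma powr_ge_tangent:
  fixes x m p :: real
  assumes "1 \<le> p" "0 < m" "0 \<le> x"
  shows "m powr p + p * m powr (p - 1) * (x - m) \<le> x powr p"
proof (cases "x = 0")
  case True
  have "m powr p = m * m powr (p - 1)"
    using \<open>0 < m\<close> by (simp add: powr_mult_base)
  with True assms show ?thesis by (simp add: algebra_simps mult_left_mono)
next
  case False
  have "(p * m powr (p - 1)) * (x - m) \<le> x powr p - m powr p"
    by (rule convex_on_imp_above_tangent[of "{0<..}"])
      (use assms False in \<open>auto intro!: powr_convex derivative_eq_intros simp: interior_open\<close>)
  then show ?thesis by simp
qed

text \<open>The integrand is made independent of the parameter by moving each \<open>L x\<close> to the slice \<open>{x} \<times> space N\<close>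
of the product.\<close>

lemma integral_measurable_subprob_algebra2:
  fixes f :: "'a \<Rightarrow> 'b \<Rightarrow> real"
  assumes f[measurable]: "(\<lambda>(x, y). f x y) \<in> borel_measurable (M \<Otimes>\<^sub>M N)"
    and L[measurable]: "L \<in> measurable M (subprob_algebra N)"
  shows "(\<lambda>x. \<integral>y. f x y \<partial>L x) \<in> borel_measurable M"
proof -
  note integral_measurable_subprob_algebra[measurable] measurable_distr2[measurable]
  have "(\<lambda>x. integral\<^sup>L (distr (L x) (M \<Otimes>\<^sub>M N) (\<lambda>y. (x, y))) (\<lambda>(x, y). f x y)) \<in> borel_measurable M"
    by measurable
  then show ?thesis
    by (rule measurable_cong[THEN iffD1, rotated]) (simp add: integral_distr)
qed

text \<open>Jensen's inequality for the simultaneous average over \<open>j\<close> (with weights \<open>w\<close>) and over \<open>s\<close>: the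
tangent of the power function at the joint mean \<open>m\<close> is averaged.\<close>

lemma powr_weighted_mean_le:
  fixes X :: "'j \<Rightarrow> 'a \<Rightarrow> real" and w :: "'j \<Rightarrow> real"
  assumes "prob_space M" and p: "1 \<le> p" and J: "finite J"
    and w: "\<And>j. j \<in> J \<Longrightarrow> 0 \<le> w j" "(\<Sum>j\<in>J. w j) \<le> 1"
    and X: "\<And>j s. j \<in> J \<Longrightarrow> s \<in> space M \<Longrightarrow> 0 \<le> X j s"
    and int: "\<And>j. j \<in> J \<Longrightarrow> integrable M (X j)"
    and int_p: "\<And>j. j \<in> J \<Longrightarrow> integrable M (\<lambda>s. X j s powr p)"
  shows "(\<integral>s. (\<Sum>j\<in>J. w j * X j s) \<partial>M) powr p \<le> (\<integral>s. (\<Sum>j\<in>J. w j * X j s powr p) \<partial>M)"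
proof -
  interpret prob_space M by fact
  define m where "m = (\<integral>s. (\<Sum>j\<in>J. w j * X j s) \<partial>M)"
  have m_nn: "0 \<le> m"
    unfolding m_def by (intro integral_nonneg_AE AE_I2 sum_nonneg mult_nonneg_nonneg w X)
  have rhs_nn: "0 \<le> (\<integral>s. (\<Sum>j\<in>J. w j * X j s powr p) \<partial>M)"
    by (intro integral_nonneg_AE AE_I2 sum_nonneg mult_nonneg_nonneg w) auto
  show ?thesis
  proof (cases "m = 0")
    case True with rhs_nn show ?thesis by (simp add: m_def)
  next
    case False
    with m_nn have m: "0 < m" by simp
    define W where "W = (\<Sum>j\<in>J. w j)"
    define k where "k = p * m powr (p - 1)"
    have mk: "k * m = p * m powr p"
      using m by (simp add: k_def powr_mult_base mult.commute)
    \<comment> \<open>The weights may add up to less than one; the tangent still suffices since \<open>p \<ge> 1\<close>.\<close>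
    have "m powr p \<le> m powr p + (1 - W) * (p - 1) * m powr p"
      using w(2) p by (simp add: W_def)
    also have "\<dots> = W * (m powr p - k * m) + k * m"
      unfolding mk by (simp add: algebra_simps)
    also have "\<dots> = (\<integral>s. W * (m powr p - k * m) + k * (\<Sum>j\<in>J. w j * X j s) \<partial>M)"
      using int by (simp add: prob_space m_def[symmetric])
    also have "\<dots> = (\<integral>s. (\<Sum>j\<in>J. w j * (m powr p + k * (X j s - m))) \<partial>M)"
      by (simp add: W_def sum_distrib_left sum_distrib_right sum.distrib[symmetric] algebra_simps
          flip: sum_subtractf)
    also have "\<dots> \<le> (\<integral>s. (\<Sum>j\<in>J. w j * X j s powr p) \<partial>M)"
      using int int_p
      by (intro integral_mono sum_mono mult_left_mono w)
        (auto simp: k_def intro!: powr_ge_tangent p m X)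
    finally show ?thesis by (simp add: m_def)
  qed
qed

text \<open>The bound \<open>B\<close> makes the essential supremum finite, so that its conversion to a real number keeps its
value.\<close>

lemma Lp_norm_top_AE_le:
  fixes f :: "'a \<Rightarrow> 'b::{real_normed_vector, second_countable_topology}"
  assumes f: "f \<in> borel_measurable M" and bnd: "AE x in M. norm (f x) \<le> B"
  shows "AE x in M. norm (f x) \<le> Lp_norm \<infinity> M f"
proof -
  have "esssup M (\<lambda>x. ennreal (norm (f x))) \<le> ennreal B"
    using f bnd by (intro esssup_I) (auto elim!: eventually_mono intro: ennreal_leI)
  then have fin: "esssup M (\<lambda>x. ennreal (norm (f x))) \<noteq> \<top>"
    by (auto simp: top_unique)
  have "AE x in M. ennreal (norm (f x)) \<le> esssup M (\<lambda>x. ennreal (norm (f x)))"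
    by (rule esssup_AE)
  then show ?thesis
  proof eventually_elim
    case (elim x)
    then have "enn2real (ennreal (norm (f x))) \<le> enn2real (esssup M (\<lambda>x. ennreal (norm (f x))))"
      using fin by (intro enn2real_mono) (auto simp: less_top)
    then show ?case by (simp add: Lp_norm_def)
  qed
qed

lemma Lp_norm_nonneg: "0 \<le> Lp_norm p M f"
  by (simp add: Lp_norm_def)

lemma Lp_norm_distr:
  fixes f :: "'a \<Rightarrow> 'b::{real_normed_vector, second_countable_topology}"
  assumes T[measurable]: "T \<in> measurable M N" and f[measurable]: "f \<in> borel_measurable N"
  shows "Lp_norm p (distr M N T) f = Lp_norm p M (\<lambda>x. f (T x))"
proof (cases "p = \<infinity>")
  case True
  then show ?thesis
    by (simp add: Lp_norm_def esssup_eq_AE AE_distr_iff)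
next
  case False
  then show ?thesis by (simp add: Lp_norm_def integral_distr)
qed

text \<open>If \<open>d\<close> is dominated by the conditional means of \<open>\<Sum>j. c j \<parallel>X j\<parallel>\<close> under the kernel \<open>K\<close>, its norm is
controlled by the norms of the \<open>X j\<close> under the mixture \<open>M \<bind> K\<close>.

For \<open>p < \<infinity>\<close>, the inequality of Minkowski and that of Jensen (conditional expectation contracts the
norm) are obtained in a single convexity step. With \<open>E j\<close> the norm of \<open>X j\<close> and \<open>S\<close> slightly above
\<open>\<Sum>j. c j E j\<close>, the quotient \<open>\<parallel>d\<parallel> / S\<close> is at most an average of the normalized functions
\<open>Y j = \<parallel>X j\<parallel> / (E j + \<epsilon>)\<close> over \<open>j\<close> and over \<open>K t\<close>. Its power is at most the average of the powers
of the \<open>Y j\<close>, whose integrals under the mixture are at most one.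

For \<open>p = \<infinity>\<close>, a null set of the mixture is a null set of \<open>K t\<close> for almost every \<open>t\<close>.\<close>

lemma Lp_norm_kernel_mean_le:
  fixes X :: "'j \<Rightarrow> 'b \<Rightarrow> 'c::{real_normed_vector, second_countable_topology}"
    and d :: "'a \<Rightarrow> 'e::{real_normed_vector, second_countable_topology}"
  assumes M: "prob_space M"
    and K[measurable]: "K \<in> measurable M (subprob_algebra N)"
    and K_prob: "\<And>t. t \<in> space M \<Longrightarrow> prob_space (K t)"
    and J: "finite J" and c: "\<And>j. j \<in> J \<Longrightarrow> 0 \<le> c j"
    and X[measurable]: "\<And>j. j \<in> J \<Longrightarrow> X j \<in> borel_measurable N"
    and X_bound: "\<And>j s. j \<in> J \<Longrightarrow> s \<in> space N \<Longrightarrow> norm (X j s) \<le> B j"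
    and d[measurable]: "d \<in> borel_measurable M"
    and le: "\<And>t. t \<in> space M \<Longrightarrow> norm (d t) \<le> (\<integral>s. (\<Sum>j\<in>J. c j * norm (X j s)) \<partial>K t)"
    and p: "1 \<le> p"
  shows "Lp_norm p M d \<le> (\<Sum>j\<in>J. c j * Lp_norm p (M \<bind> K) (X j))"
proof -
  interpret prob_space M by fact
  have ne: "space M \<noteq> {}" by (rule not_empty)
  have sK: "sets (K t) = sets N" "space (K t) = space N" if "t \<in> space M" for t
    using sets_kernel[OF K that] sets_eq_imp_space_eq[OF sets_kernel[OF K that]] by auto
  define Q where "Q = M \<bind> K"
  have sQ[measurable_cong]: "sets Q = sets N" unfolding Q_def
    using ne sK by (intro sets_bind) auto
  then have spQ: "space Q = space N" by (rule sets_eq_imp_space_eq)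
  interpret Q: prob_space Q unfolding Q_def
    by (rule prob_space_bind[OF _ K]) (simp add: K_prob)
  have X_Q[measurable]: "X j \<in> borel_measurable Q" if "j \<in> J" for j
    using X[OF that] by (simp cong: measurable_cong_sets add: sQ)
  have X_K: "X j \<in> borel_measurable (K t)" if "j \<in> J" "t \<in> space M" for j t
    using X[OF that(1)] sK[OF that(2)] by (simp cong: measurable_cong_sets)
  define E where "E j = Lp_norm p Q (X j)" for j
  have E_nn: "0 \<le> E j" for j by (simp add: E_def Lp_norm_nonneg)
  have c_E_nn: "0 \<le> (\<Sum>j\<in>J. c j * E j)" by (intro sum_nonneg mult_nonneg_nonneg c E_nn)
  show ?thesis
  proof (cases "p = \<infinity>")
    case True
    have "AE s in Q. \<forall>j\<in>J. norm (X j s) \<le> E j"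
    proof (intro AE_finite_allI J)
      fix j assume j: "j \<in> J"
      show "AE s in Q. norm (X j s) \<le> E j"
        unfolding E_def True
        by (rule Lp_norm_top_AE_le[of _ _ "B j"]) (use j X_bound spQ in auto)
    qed
    moreover have "Measurable.pred N (\<lambda>s. \<forall>j\<in>J. norm (X j s) \<le> E j)"
      using J by measurable
    ultimately have "AE t in M. AE s in K t. \<forall>j\<in>J. norm (X j s) \<le> E j"
      unfolding Q_def by (subst (asm) AE_bind[OF K])
    then have "AE t in M. ennreal (norm (d t)) \<le> ennreal (\<Sum>j\<in>J. c j * E j)"
    proof (rule AE_mp, intro AE_I2 impI ennreal_leI)
      fix t assume t: "t \<in> space M" and *: "AE s in K t. \<forall>j\<in>J. norm (X j s) \<le> E j"
      interpret Kt: prob_space "K t" by (rule K_prob[OF t])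
      have "norm (d t) \<le> (\<integral>s. (\<Sum>j\<in>J. c j * norm (X j s)) \<partial>K t)" by (rule le[OF t])
      also have "\<dots> \<le> (\<integral>s. (\<Sum>j\<in>J. c j * E j) \<partial>K t)"
      proof (rule integral_mono_AE)
        have "integrable (K t) (\<lambda>s. norm (X j s))" if "j \<in> J" for j
          using X_K[OF that t] X_bound[OF that] sK[OF t]
          by (intro Kt.integrable_const_bound[of _ "B j"]) auto
        then show "integrable (K t) (\<lambda>s. \<Sum>j\<in>J. c j * norm (X j s))" by simp
        show "AE s in K t. (\<Sum>j\<in>J. c j * norm (X j s)) \<le> (\<Sum>j\<in>J. c j * E j)"
          using * by eventually_elim (intro sum_mono mult_left_mono c, auto)
      qed simp
      also have "\<dots> = (\<Sum>j\<in>J. c j * E j)" by (simp add: Kt.prob_space)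
      finally show "norm (d t) \<le> (\<Sum>j\<in>J. c j * E j)" .
    qed
    then have "esssup M (\<lambda>t. ennreal (norm (d t))) \<le> ennreal (\<Sum>j\<in>J. c j * E j)"
      by (intro esssup_I) auto
    then have "enn2real (esssup M (\<lambda>t. ennreal (norm (d t)))) \<le> (\<Sum>j\<in>J. c j * E j)"
      using c_E_nn enn2real_leI by blast
    then show ?thesis by (simp add: Lp_norm_def True E_def Q_def)
  next
    case False
    define q where "q = enn2real p"
    have q: "1 \<le> q"
      using p False unfolding q_def
      by (metis enn2real_1 enn2real_mono infinity_ennreal_def top.not_eq_extremum)
    have E_eq: "E j powr q = (\<integral>s. norm (X j s) powr q \<partial>Q)" for j
      using q False by (simp add: E_def Lp_norm_def q_def[symmetric] powr_powr)
    have int_Q: "integrable Q (\<lambda>s. norm (X j s) powr q)" if j: "j \<in> J" for j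
    proof (rule Q.integrable_const_bound[of _ "B j powr q"])
      show "AE s in Q. norm (norm (X j s) powr q) \<le> B j powr q"
        using X_bound[OF j] q by (auto simp: spQ intro!: powr_mono2)
    qed (use j in simp)
    have "Lp_norm p M d \<le> (\<Sum>j\<in>J. c j * E j) + e" if e: "e > 0" for e
    proof -
      \<comment> \<open>The perturbation keeps all denominators positive; the weights \<open>w\<close> add up to at most one.\<close>
      define \<epsilon> where "\<epsilon> = e / (2 * ((\<Sum>j\<in>J. c j) + 1))"
      have sum_c: "0 \<le> (\<Sum>j\<in>J. c j)" by (intro sum_nonneg c)
      have \<epsilon>: "\<epsilon> > 0" using e sum_c by (auto simp: \<epsilon>_def intro!: divide_pos_pos)
      define S where "S = (\<Sum>j\<in>J. c j * E j) + e"
      have S: "S > 0" using c_E_nn e by (simp add: S_def)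
      define w where "w j = c j * (E j + \<epsilon>) / S" for j
      define Y where "Y j s = norm (X j s) / (E j + \<epsilon>)" for j s
      have E\<epsilon>: "E j + \<epsilon> > 0" for j using E_nn[of j] \<epsilon> by simp
      have w_nn: "0 \<le> w j" if "j \<in> J" for j
        using c[OF that] S E\<epsilon>[of j] by (auto simp: w_def intro!: divide_nonneg_pos mult_nonneg_nonneg)
      have w_le: "(\<Sum>j\<in>J. w j) \<le> 1"
      proof -
        have "(\<Sum>j\<in>J. c j) * \<epsilon> \<le> ((\<Sum>j\<in>J. c j) + 1) * \<epsilon>" using \<epsilon> by simp
        also have "\<dots> = e / 2" using sum_c by (simp add: \<epsilon>_def field_simps)
        also have "\<dots> \<le> e" using e by simp
        finally have "(\<Sum>j\<in>J. c j * (E j + \<epsilon>)) \<le> S"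
          by (simp add: S_def distrib_left sum.distrib sum_distrib_right)
        then show ?thesis using S by (simp add: w_def sum_divide_distrib[symmetric])
      qed
      have wY: "w j * Y j s = c j * norm (X j s) / S" for j s
        using E\<epsilon>[of j] by (simp add: w_def Y_def)
      have Y_nn: "0 \<le> Y j s" for j s using E\<epsilon>[of j] by (simp add: Y_def)
      have Y_le: "Y j s \<le> B j / (E j + \<epsilon>)" if "j \<in> J" "s \<in> space N" for j s
        using X_bound[OF that] E\<epsilon>[of j] by (simp add: Y_def divide_right_mono)
      have Y_meas[measurable]: "Y j \<in> borel_measurable N" if "j \<in> J" for j
        using that unfolding Y_def by measurable
      have ptw: "(norm (d t) / S) powr q \<le> (\<integral>s. (\<Sum>j\<in>J. w j * Y j s powr q) \<partial>K t)"
        and int_K: "integrable (K t) (\<lambda>s. \<Sum>j\<in>J. w j * Y j s powr q)"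
        if t: "t \<in> space M" for t
      proof -
        interpret Kt: prob_space "K t" by (rule K_prob[OF t])
        have Y_K: "Y j \<in> borel_measurable (K t)" if "j \<in> J" for j
          using Y_meas[OF that] sK[OF t] by (simp cong: measurable_cong_sets)
        have 1: "integrable (K t) (Y j)" if j: "j \<in> J" for j
          using Y_K[OF j] Y_le[OF j] Y_nn
          by (intro Kt.integrable_const_bound[of _ "B j / (E j + \<epsilon>)"]) (auto simp: sK[OF t])
        have 2: "integrable (K t) (\<lambda>s. Y j s powr q)" if j: "j \<in> J" for j
          using Y_K[OF j] Y_le[OF j] Y_nn q
          by (intro Kt.integrable_const_bound[of _ "(B j / (E j + \<epsilon>)) powr q"])
            (auto simp: sK[OF t] intro!: powr_mono2)
        have "norm (d t) / S \<le> (\<integral>s. (\<Sum>j\<in>J. c j * norm (X j s)) \<partial>K t) / S"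
          using le[OF t] S by (simp add: divide_right_mono)
        also have "\<dots> = (\<integral>s. (\<Sum>j\<in>J. w j * Y j s) \<partial>K t)"
          by (simp add: wY sum_divide_distrib[symmetric])
        finally have "(norm (d t) / S) powr q \<le> (\<integral>s. (\<Sum>j\<in>J. w j * Y j s) \<partial>K t) powr q"
          using S q by (intro powr_mono2) auto
        also have "\<dots> \<le> (\<integral>s. (\<Sum>j\<in>J. w j * Y j s powr q) \<partial>K t)"
          using Kt.prob_space_axioms q J w_nn w_le Y_nn 1 2 by (intro powr_weighted_mean_le) auto
        finally show "(norm (d t) / S) powr q \<le> (\<integral>s. (\<Sum>j\<in>J. w j * Y j s powr q) \<partial>K t)" .
        show "integrable (K t) (\<lambda>s. \<Sum>j\<in>J. w j * Y j s powr q)"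
          using 2 by (intro Bochner_Integration.integrable_sum integrable_mult_right) auto
      qed
      have mean_nn: "0 \<le> (\<Sum>j\<in>J. w j * Y j s powr q)" for s
        by (intro sum_nonneg mult_nonneg_nonneg w_nn) auto
      have int_QY: "integrable Q (\<lambda>s. Y j s powr q)" if "j \<in> J" for j
        using int_Q[OF that] E\<epsilon>[of j] by (simp add: Y_def powr_divide)
      have QY: "(\<integral>s. Y j s powr q \<partial>Q) \<le> 1" if "j \<in> J" for j
      proof -
        have "(\<integral>s. Y j s powr q \<partial>Q) = E j powr q / (E j + \<epsilon>) powr q"
          using E\<epsilon>[of j] by (simp add: Y_def powr_divide E_eq)
        also have "\<dots> \<le> 1"
          using E_nn[of j] \<epsilon> q by (auto simp: divide_le_eq_1 intro!: powr_mono2)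
        finally show ?thesis .
      qed
      have "(\<integral>\<^sup>+t. ennreal ((norm (d t) / S) powr q) \<partial>M)
          \<le> (\<integral>\<^sup>+t. (\<integral>\<^sup>+s. ennreal (\<Sum>j\<in>J. w j * Y j s powr q) \<partial>K t) \<partial>M)"
        using ptw int_K mean_nn
        by (intro nn_integral_mono) (simp add: nn_integral_eq_integral ennreal_leI)
      also have "\<dots> = (\<integral>\<^sup>+s. ennreal (\<Sum>j\<in>J. w j * Y j s powr q) \<partial>Q)"
        unfolding Q_def by (rule nn_integral_bind[OF _ K, symmetric]) measurable
      also have "\<dots> = ennreal (\<integral>s. (\<Sum>j\<in>J. w j * Y j s powr q) \<partial>Q)"
        using int_QY mean_nn by (intro nn_integral_eq_integral) auto
      also have "(\<integral>s. (\<Sum>j\<in>J. w j * Y j s powr q) \<partial>Q) = (\<Sum>j\<in>J. w j * (\<integral>s. Y j s powr q \<partial>Q))"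
        using int_QY by (simp add: Bochner_Integration.integral_sum)
      also have "ennreal \<dots> \<le> ennreal 1"
      proof (rule ennreal_leI)
        have "(\<Sum>j\<in>J. w j * (\<integral>s. Y j s powr q \<partial>Q)) \<le> (\<Sum>j\<in>J. w j * 1)"
          by (intro sum_mono mult_left_mono QY w_nn)
        with w_le show "(\<Sum>j\<in>J. w j * (\<integral>s. Y j s powr q \<partial>Q)) \<le> 1" by simp
      qed
      finally have nn: "(\<integral>\<^sup>+t. ennreal ((norm (d t) / S) powr q) \<partial>M) \<le> ennreal 1" .
      have "(\<integral>t. (norm (d t) / S) powr q \<partial>M) \<le> 1"
        using nn by (simp add: integral_eq_nn_integral enn2real_leI)
      then have "(\<integral>t. norm (d t) powr q \<partial>M) \<le> S powr q"
        using S by (simp add: powr_divide divide_le_eq_1)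
      then have "(\<integral>t. norm (d t) powr q \<partial>M) powr (1 / q) \<le> (S powr q) powr (1 / q)"
        using q by (intro powr_mono2) auto
      then show ?thesis
        using S q False by (simp add: Lp_norm_def q_def[symmetric] powr_powr S_def[symmetric])
    qed
    then have "Lp_norm p M d \<le> (\<Sum>j\<in>J. c j * E j)" by (rule field_le_epsilon)
    then show ?thesis by (simp add: E_def Q_def)
  qed
qed

section \<open>Profiles\<close>

text \<open>Outside \<open>I\<close> the profiles are frozen at one value, so the set is a full product with singleton factors
there, and Tychonoff's theorem applies.\<close>

lemma compact_PiE:
  fixes S :: "'i \<Rightarrow> 'a::topological_space set"
  assumes "\<And>i. i \<in> I \<Longrightarrow> compact (S i)"
  shows "compact (\<Pi>\<^sub>E i\<in>I. S i)"
proof -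
  have "compactin (product_topology (\<lambda>_. euclidean) UNIV)
      (\<Pi>\<^sub>E i\<in>UNIV. if i \<in> I then S i else {undefined})"
    unfolding compactin_PiE using assms by simp
  moreover have "(\<Pi>\<^sub>E i\<in>UNIV. if i \<in> I then S i else {undefined}) = (\<Pi>\<^sub>E i\<in>I. S i)"
    by (auto simp: PiE_iff extensional_def split: if_splits)
  ultimately show ?thesis
    by (simp add: euclidean_product_topology[symmetric] flip: compactin_euclidean_iff)
qed

lemma finite_others: "finite (others G i)"
  by (simp add: others_def players_def)

lemma fun_upd_type_profile:
  assumes "i \<in> players G" "s \<in> others_types G i" "t \<in> types G i"
  shows "s(i := t) \<in> type_profiles G"
  using assms by (auto simp: type_profiles_def others_types_def others_def PiE_iff extensional_def)

lemma fun_upd_action_profile: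
  assumes "i \<in> players G" "b \<in> others_actions G i" "a \<in> actions G i"
  shows "b(i := a) \<in> action_profiles G"
  using assms by (auto simp: action_profiles_def others_actions_def others_def PiE_iff extensional_def)

lemma others_strategies_measurable:
  assumes "f \<in> others_strategies G i" "j \<in> others G i"
  shows "f j \<in> measurable (restrict_space borel (types G j)) (restrict_space borel (actions G j))"
  using assms unfolding others_strategies_def strategies_def by (rule Pi_mem)

lemma others_strategies_mem_actions:
  assumes "f \<in> others_strategies G i" "j \<in> others G i" "t \<in> types G j"
  shows "f j t \<in> actions G j"
  using measurable_space[OF others_strategies_measurable[OF assms(1,2)], of t] assms(3)
  by (simp add: space_restrict_space)

lemma play_mem_others_actions:
  assumes "f \<in> others_strategies G i" "s \<in> others_types G i"
  shows "play G i f s \<in> others_actions G i"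
  using assms others_strategies_mem_actions[OF assms(1)]
  by (auto simp: play_def others_actions_def others_types_def)

lemma measurable_others_coordinate:
  fixes G :: "('d::euclidean_space, 'z, 'm) bayesian_game_scheme"
  assumes "j \<in> others G i"
  shows "(\<lambda>s. s j) \<in> measurable (restrict_space borel (others_types G i)) (restrict_space borel (types G j))"
proof (rule measurable_restrict_space2)
  show "(\<lambda>s. s j) \<in> borel_measurable (restrict_space borel (others_types G i))"
    by (intro measurable_restrict_space1) measurable
qed (use assms in \<open>auto simp: space_restrict_space others_types_def\<close>)

lemma measurable_play:
  fixes G :: "('d::euclidean_space, 'z::euclidean_space, 'm) bayesian_game_scheme"
  assumes f: "f \<in> others_strategies G i"
  shows "play G i f \<in> borel_measurable (restrict_space borel (others_types G i))"
proof (rule measurable_coordinatewise_then_product)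
  fix j
  show "(\<lambda>s. play G i f s j) \<in> borel_measurable (restrict_space borel (others_types G i))"
  proof (cases "j \<in> others G i")
    case True
    have "f j \<in> borel_measurable (restrict_space borel (types G j))"
      using others_strategies_measurable[OF f True] by (simp add: measurable_restrict_space2_iff)
    from measurable_compose[OF measurable_others_coordinate[OF True] this] True
    show ?thesis by (simp add: play_def)
  qed (simp add: play_def)
qed

section \<open>Optimal responses of a player\<close>

locale bayesian_game_player =
  fixes G :: "('d::euclidean_space, 'z::euclidean_space) bayesian_game"
    and grad :: "nat \<Rightarrow> (nat \<Rightarrow> 'z) \<Rightarrow> (nat \<Rightarrow> 'd) \<Rightarrow> 'z"
    and \<sigma> :: "nat \<Rightarrow> real" and \<tau> :: "nat \<Rightarrow> nat \<Rightarrow> real" and i :: nat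
  assumes game: "is_bayesian_game G"
    and A: "assumption_A G grad"
    and B: "assumption_B G grad \<sigma> \<tau>"
    and i: "i \<in> players G"
begin

abbreviation "own_types \<equiv> restrict_space borel (types G i)"
abbreviation "other_types \<equiv> restrict_space borel (others_types G i)"
abbreviation "belief \<equiv> conditional G i"

lemma others_players: "j \<in> others G i \<Longrightarrow> j \<in> players G"
  by (simp add: others_def)

lemma types_props: "j \<in> players G \<Longrightarrow> types G j \<noteq> {}" "j \<in> players G \<Longrightarrow> compact (types G j)"
  using game by (auto simp: is_bayesian_game_def)

lemma actions_props: "j \<in> players G \<Longrightarrow> actions G j \<noteq> {}" "j \<in> players G \<Longrightarrow> compact (actions G j)"
    "j \<in> players G \<Longrightarrow> convex (actions G j)"
  using game by (auto simp: is_bayesian_game_def)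

lemma sigma_pos: "0 < \<sigma> i" and tau_nonneg: "j \<in> others G i \<Longrightarrow> 0 \<le> \<tau> i j"
  using B i by (auto simp: assumption_B_def)

lemma prior_prob: "prob_space (prior G)"
  and sets_prior: "sets (prior G) = sets (restrict_space borel (type_profiles G))"
  using game by (auto simp: is_bayesian_game_def)

lemma belief_prob: "t \<in> types G i \<Longrightarrow> prob_space (belief t)"
  and sets_belief: "t \<in> types G i \<Longrightarrow> sets (belief t) = sets other_types"
  using game i by (auto simp: is_bayesian_game_def is_conditional_def)

lemma space_belief: "t \<in> types G i \<Longrightarrow> space (belief t) = others_types G i"
  using sets_eq_imp_space_eq[OF sets_belief] by (simp add: space_restrict_space)

lemma borel_measurable_belief:
  "t \<in> types G i \<Longrightarrow> F \<in> borel_measurable other_types \<Longrightarrow> F \<in> borel_measurable (belief t)"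
  using sets_belief by (simp cong: measurable_cong_sets)

lemma belief_kernel: "belief \<in> measurable own_types (subprob_algebra other_types)"
proof (rule measurable_subprob_algebra)
  show "subprob_space (belief t)" if "t \<in> space own_types" for t
    using that belief_prob by (simp add: space_restrict_space prob_space_imp_subprob_space)
  show "sets (belief t) = sets other_types" if "t \<in> space own_types" for t
    using that sets_belief by (simp add: space_restrict_space)
  show "(\<lambda>t. emeasure (belief t) S) \<in> borel_measurable own_types" if "S \<in> sets other_types" for S
    using A i that by (simp add: assumption_A_def)
qed

subsection \<open>Realized utilities\<close>

lemma utility_strongly_concave:
  assumes b: "b \<in> others_actions G i" and \<theta>: "\<theta> \<in> type_profiles G"
  shows "strongly_concave_on (actions G i) (\<sigma> i) (\<lambda>a. utility G i (b(i := a)) \<theta>)"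
proof (rule strongly_concave_onI_gradient)
  show "convex (actions G i)" by (rule actions_props[OF i])
  show "((\<lambda>a. utility G i (b(i := a)) \<theta>) has_derivative (\<lambda>v. grad i (b(i := a)) \<theta> \<bullet> v))
      (at a within actions G i)" if a: "a \<in> actions G i" for a
    using A i fun_upd_action_profile[OF i b a] \<theta>
    by (fastforce simp: assumption_A_def is_own_gradient_def)
  show "(grad i (b(i := a)) \<theta> - grad i (b(i := c)) \<theta>) \<bullet> (a - c) \<le> - \<sigma> i * (norm (a - c))\<^sup>2"
    if "a \<in> actions G i" "c \<in> actions G i" for a c
    using B i that b \<theta> by (simp add: assumption_B_def)
qed

text \<open>As a function of the own action, the difference of the utilities against \<open>b\<close> and against \<open>b'\<close> has the
difference of the own gradients as its gradient, and cross-Lipschitz continuity bounds that. This is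
the increment that the stability of maximizers asks for.\<close>

lemma utility_increment_Lipschitz:
  assumes b: "b \<in> others_actions G i" and b': "b' \<in> others_actions G i"
    and \<theta>: "\<theta> \<in> type_profiles G" and a: "a \<in> actions G i" and c: "c \<in> actions G i"
  shows "(utility G i (b(i := a)) \<theta> - utility G i (b'(i := a)) \<theta>)
      - (utility G i (b(i := c)) \<theta> - utility G i (b'(i := c)) \<theta>)
    \<le> (\<Sum>j\<in>others G i. \<tau> i j * norm (b j - b' j)) * norm (a - c)"
proof -
  define W where "W x = utility G i (b(i := x)) \<theta> - utility G i (b'(i := x)) \<theta>" for x
  define L where "L = (\<Sum>j\<in>others G i. \<tau> i j * norm (b j - b' j))"
  have deriv: "((\<lambda>x. utility G i (e(i := x)) \<theta>) has_derivative (\<lambda>v. grad i (e(i := x)) \<theta> \<bullet> v))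
      (at x within actions G i)" if "x \<in> actions G i" "e \<in> others_actions G i" for x e
    using A i fun_upd_action_profile[OF i that(2,1)] \<theta>
    by (fastforce simp: assumption_A_def is_own_gradient_def)
  have "norm (W a - W c) \<le> L * norm (a - c)"
  proof (rule differentiable_bound[OF actions_props(3)[OF i] _ _ a c])
    fix x assume x: "x \<in> actions G i"
    show "(W has_derivative (\<lambda>v. (grad i (b(i := x)) \<theta> - grad i (b'(i := x)) \<theta>) \<bullet> v))
        (at x within actions G i)"
      unfolding W_def inner_diff_left by (intro has_derivative_diff deriv x b b')
    have "norm (grad i (b(i := x)) \<theta> - grad i (b'(i := x)) \<theta>) \<le> L"
      using B i x b b' \<theta> by (simp add: assumption_B_def L_def)
    then have "norm ((grad i (b(i := x)) \<theta> - grad i (b'(i := x)) \<theta>) \<bullet> v) \<le> L * norm v" for v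
      using order_trans[OF Cauchy_Schwarz_ineq2 mult_right_mono[OF _ norm_ge_zero]]
      by (simp only: real_norm_def)
    then show "onorm (\<lambda>v. (grad i (b(i := x)) \<theta> - grad i (b'(i := x)) \<theta>) \<bullet> v) \<le> L"
      by (rule onorm_le)
  qed
  then show ?thesis by (simp add: W_def L_def)
qed

definition realized :: "(nat \<Rightarrow> 'd \<Rightarrow> 'z) \<Rightarrow> 'd \<Rightarrow> 'z \<Rightarrow> (nat \<Rightarrow> 'd) \<Rightarrow> real" where
  "realized f t a s = utility G i ((play G i f s)(i := a)) (s(i := t))"

lemma expected_utility_eq: "expected_utility G i a f t = (\<integral>s. realized f t a s \<partial>belief t)"
  by (simp add: expected_utility_def realized_def)

lemma compact_profiles: "compact (action_profiles G \<times> type_profiles G)"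
  unfolding action_profiles_def type_profiles_def
  by (intro compact_Times compact_PiE actions_props types_props)

lemma continuous_utility:
  "continuous_on (action_profiles G \<times> type_profiles G) (\<lambda>(a, \<theta>). utility G i a \<theta>)"
  using A i by (simp add: assumption_A_def)

lemma utility_bounded:
  obtains C where "\<And>a \<theta>. a \<in> action_profiles G \<Longrightarrow> \<theta> \<in> type_profiles G \<Longrightarrow> \<bar>utility G i a \<theta>\<bar> \<le> C"
proof -
  have "bounded ((\<lambda>(a, \<theta>). utility G i a \<theta>) ` (action_profiles G \<times> type_profiles G))"
    by (intro compact_imp_bounded compact_continuous_image continuous_utility compact_profiles)
  then show ?thesis using that unfolding bounded_iff by force
qed

lemma realized_bounded:
  obtains C where "\<And>f t a s. f \<in> others_strategies G i \<Longrightarrow> t \<in> types G i \<Longrightarrow> a \<in> actions G i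
      \<Longrightarrow> s \<in> others_types G i \<Longrightarrow> \<bar>realized f t a s\<bar> \<le> C"
proof -
  obtain C where C: "\<And>a \<theta>. a \<in> action_profiles G \<Longrightarrow> \<theta> \<in> type_profiles G \<Longrightarrow> \<bar>utility G i a \<theta>\<bar> \<le> C"
    by (rule utility_bounded) blast
  show ?thesis
    by (rule that[of C], unfold realized_def)
      (intro C fun_upd_action_profile fun_upd_type_profile play_mem_others_actions i)
qed

lemma realized_measurable_pair:
  assumes f: "f \<in> others_strategies G i" and a: "a \<in> actions G i"
  shows "(\<lambda>(t, s). realized f t a s) \<in> borel_measurable (own_types \<Otimes>\<^sub>M other_types)"
proof -
  have fst: "fst \<in> borel_measurable (own_types \<Otimes>\<^sub>M other_types)"
    by (rule measurable_compose[OF measurable_fst]) (simp add: measurable_restrict_space1)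
  have snd: "snd \<in> measurable (own_types \<Otimes>\<^sub>M other_types) other_types" by simp
  have snd_j: "(\<lambda>z. snd z j) \<in> borel_measurable (own_types \<Otimes>\<^sub>M other_types)" for j
    by (rule measurable_compose[OF measurable_snd]) (intro measurable_restrict_space1, measurable)
  have 1: "(\<lambda>z. (play G i f (snd z))(i := a)) \<in> borel_measurable (own_types \<Otimes>\<^sub>M other_types)"
  proof (rule measurable_coordinatewise_then_product)
    fix j
    have "(\<lambda>z. play G i f (snd z) j) \<in> borel_measurable (own_types \<Otimes>\<^sub>M other_types)"
      using measurable_compose[OF snd measurable_play[OF f]] by (rule measurable_product_then_coordinatewise)
    then show "(\<lambda>z. ((play G i f (snd z))(i := a)) j) \<in> borel_measurable (own_types \<Otimes>\<^sub>M other_types)"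
      by (cases "j = i") auto
  qed
  have 2: "(\<lambda>z. (snd z)(i := fst z)) \<in> borel_measurable (own_types \<Otimes>\<^sub>M other_types)"
  proof (rule measurable_coordinatewise_then_product)
    fix j
    show "(\<lambda>z. ((snd z)(i := fst z)) j) \<in> borel_measurable (own_types \<Otimes>\<^sub>M other_types)"
      using fst snd_j by (cases "j = i") auto
  qed
  have "(\<lambda>z. ((play G i f (snd z))(i := a), (snd z)(i := fst z)))
      \<in> borel_measurable (own_types \<Otimes>\<^sub>M other_types)"
    unfolding borel_prod[symmetric] by (intro measurable_Pair 1 2)
  then have "(\<lambda>z. ((play G i f (snd z))(i := a), (snd z)(i := fst z)))
      \<in> measurable (own_types \<Otimes>\<^sub>M other_types) (restrict_space borel (action_profiles G \<times> type_profiles G))"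
    using i f a
    by (intro measurable_restrict_space2)
      (auto simp: space_pair_measure space_restrict_space
        intro!: fun_upd_action_profile fun_upd_type_profile play_mem_others_actions)
  from measurable_compose[OF this borel_measurable_continuous_on_restrict[OF continuous_utility]]
  show ?thesis by (simp add: realized_def case_prod_beta')
qed

lemma realized_measurable:
  assumes f: "f \<in> others_strategies G i" and a: "a \<in> actions G i" and t: "t \<in> types G i"
  shows "realized f t a \<in> borel_measurable (belief t)"
proof (rule borel_measurable_belief[OF t])
  have "Pair t \<in> measurable other_types (own_types \<Otimes>\<^sub>M other_types)"
    using t by (intro measurable_Pair1') (simp add: space_restrict_space)
  from measurable_compose[OF this realized_measurable_pair[OF f a]]
  show "realized f t a \<in> borel_measurable other_types" by simp
qed

lemma realized_integrable:
  assumes f: "f \<in> others_strategies G i" and a: "a \<in> actions G i" and t: "t \<in> types G i"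
  shows "integrable (belief t) (realized f t a)"
proof -
  interpret belief: prob_space "belief t" by (rule belief_prob[OF t])
  obtain C where "\<And>f t a s. f \<in> others_strategies G i \<Longrightarrow> t \<in> types G i \<Longrightarrow> a \<in> actions G i
      \<Longrightarrow> s \<in> others_types G i \<Longrightarrow> \<bar>realized f t a s\<bar> \<le> C" by (rule realized_bounded) blast
  then show ?thesis
    using assms realized_measurable[OF f a t]
    by (intro belief.integrable_const_bound[of _ C]) (auto simp: space_belief[OF t])
qed

lemma realized_strongly_concave:
  assumes "f \<in> others_strategies G i" "t \<in> types G i" "s \<in> others_types G i"
  shows "strongly_concave_on (actions G i) (\<sigma> i) (\<lambda>a. realized f t a s)"
  unfolding realized_def
  by (intro utility_strongly_concave play_mem_others_actions fun_upd_type_profile i assms)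

lemma realized_continuous:
  assumes "f \<in> others_strategies G i" "t \<in> types G i" "s \<in> others_types G i"
  shows "continuous_on (actions G i) (\<lambda>a. realized f t a s)"
proof -
  have "continuous_on (actions G i) (\<lambda>a. ((play G i f s)(i := a), s(i := t)))"
  proof (intro continuous_on_Pair continuous_on_const continuous_on_coordinatewise_then_product)
    show "continuous_on (actions G i) (\<lambda>a. ((play G i f s)(i := a)) j)" for j
      by (cases "j = i") auto
  qed
  then have "continuous_on (actions G i)
      (\<lambda>a. (\<lambda>(a, \<theta>). utility G i a \<theta>) ((play G i f s)(i := a), s(i := t)))"
    by (rule continuous_on_compose2[OF continuous_utility])
      (use assms i in \<open>auto intro!: fun_upd_action_profile fun_upd_type_profile play_mem_others_actions\<close>)
  then show ?thesis by (simp add: realized_def)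
qed

subsection \<open>Expected utilities and the optimal response\<close>

lemma expected_utility_strongly_concave:
  assumes "f \<in> others_strategies G i" "t \<in> types G i"
  shows "strongly_concave_on (actions G i) (\<sigma> i) (\<lambda>a. expected_utility G i a f t)"
  unfolding expected_utility_eq
  using assms
  by (intro strongly_concave_on_integral belief_prob actions_props(3)[OF i] realized_strongly_concave
      realized_integrable) (auto simp: space_belief)

lemma expected_utility_continuous:
  assumes f: "f \<in> others_strategies G i" and t: "t \<in> types G i"
  shows "continuous_on (actions G i) (\<lambda>a. expected_utility G i a f t)"
  unfolding continuous_on_sequentially comp_def expected_utility_eq
proof (intro allI ballI impI, elim conjE)
  interpret belief: prob_space "belief t" by (rule belief_prob[OF t])
  fix x a assume x: "\<forall>n. x n \<in> actions G i" and a: "a \<in> actions G i" and lim: "x \<longlonglongrightarrow> a"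
  obtain C where C: "\<And>f t a s. f \<in> others_strategies G i \<Longrightarrow> t \<in> types G i \<Longrightarrow> a \<in> actions G i
      \<Longrightarrow> s \<in> others_types G i \<Longrightarrow> \<bar>realized f t a s\<bar> \<le> C" by (rule realized_bounded) blast
  show "(\<lambda>n. \<integral>s. realized f t (x n) s \<partial>belief t) \<longlonglongrightarrow> (\<integral>s. realized f t a s \<partial>belief t)"
  proof (rule integral_dominated_convergence[where w = "\<lambda>_. C"])
    show "AE s in belief t. (\<lambda>n. realized f t (x n) s) \<longlonglongrightarrow> realized f t a s"
    proof (rule AE_I2)
      fix s assume "s \<in> space (belief t)"
      then have "continuous_on (actions G i) (\<lambda>a. realized f t a s)"
        using f t by (intro realized_continuous) (auto simp: space_belief)
      then show "(\<lambda>n. realized f t (x n) s) \<longlonglongrightarrow> realized f t a s"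
        using x a lim by (auto simp: continuous_on_sequentially comp_def)
    qed
    show "AE s in belief t. norm (realized f t (x n) s) \<le> C" for n
      using C[OF f t] x by (auto simp: space_belief[OF t])
  qed (use realized_measurable[OF f _ t] a x in auto)
qed

lemma expected_utility_measurable:
  assumes "f \<in> others_strategies G i" "a \<in> actions G i"
  shows "(\<lambda>t. expected_utility G i a f t) \<in> borel_measurable own_types"
  unfolding expected_utility_eq
  by (rule integral_measurable_subprob_algebra2[OF realized_measurable_pair[OF assms] belief_kernel])

lemma optimal_responses_eq_argmax:
  "optimal_responses G i f t = argmax_on (actions G i) (\<lambda>a. expected_utility G i a f t)"
  by (simp add: optimal_responses_def argmax_on_def)

lemma optimal_responses_eq:
  assumes "f \<in> others_strategies G i" "t \<in> types G i"
  shows "optimal_responses G i f t = {optimal_response G i f t}"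
proof -
  obtain a where "optimal_responses G i f t = {a}"
    using strongly_concave_on_argmax_singleton[OF expected_utility_strongly_concave[OF assms]
        actions_props(3)[OF i] sigma_pos actions_props(2)[OF i] actions_props(1)[OF i]
        expected_utility_continuous[OF assms]]
    by (auto simp: optimal_responses_eq_argmax)
  then show ?thesis by (simp add: optimal_response_def)
qed

lemma optimal_response_strategy:
  assumes f: "f \<in> others_strategies G i"
  shows "optimal_response G i f \<in> strategies G i"
  unfolding strategies_def
  by (rule the_argmax_on_measurable[where \<Phi> = "\<lambda>t a. expected_utility G i a f t"])
    (use f optimal_responses_eq[OF f] actions_props(2)[OF i] expected_utility_continuous
      expected_utility_measurable in
      \<open>auto simp: space_restrict_space optimal_responses_eq_argmax\<close>)

lemma strategy_difference_measurable:
  assumes f: "f \<in> others_strategies G i" and g: "g \<in> others_strategies G i" and j: "j \<in> others G i"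
  shows "(\<lambda>t. f j t - g j t) \<in> borel_measurable (restrict_space borel (types G j))"
  using others_strategies_measurable[OF f j] others_strategies_measurable[OF g j]
  by (intro borel_measurable_diff) (simp_all add: measurable_restrict_space2_iff)

lemma strategy_difference_bounded:
  obtains C where "\<And>f g j t. f \<in> others_strategies G i \<Longrightarrow> g \<in> others_strategies G i \<Longrightarrow> j \<in> others G i
      \<Longrightarrow> t \<in> types G j \<Longrightarrow> norm (f j t - g j t) \<le> C j"
proof -
  have "\<forall>j\<in>others G i. \<exists>C. \<forall>x\<in>actions G j. \<forall>y\<in>actions G j. norm (x - y) \<le> C"
  proof
    fix j assume "j \<in> others G i"
    then have "bounded (actions G j)"
      using actions_props(2)[OF others_players] by (simp add: compact_imp_bounded)
    then show "\<exists>C. \<forall>x\<in>actions G j. \<forall>y\<in>actions G j. norm (x - y) \<le> C"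
      unfolding bounded_two_points dist_norm by blast
  qed
  then obtain C where "\<And>j x y. j \<in> others G i \<Longrightarrow> x \<in> actions G j \<Longrightarrow> y \<in> actions G j \<Longrightarrow> norm (x - y) \<le> C j"
    by metis
  then show ?thesis by (intro that[of C]) (auto intro: others_strategies_mem_actions)
qed

lemma strategy_difference_integrable:
  assumes f: "f \<in> others_strategies G i" and g: "g \<in> others_strategies G i"
    and j: "j \<in> others G i" and t: "t \<in> types G i"
  shows "integrable (belief t) (\<lambda>s. norm (f j (s j) - g j (s j)))"
proof -
  interpret belief: prob_space "belief t" by (rule belief_prob[OF t])
  obtain C where C: "\<And>f g j t. f \<in> others_strategies G i \<Longrightarrow> g \<in> others_strategies G i \<Longrightarrow> j \<in> others G i
      \<Longrightarrow> t \<in> types G j \<Longrightarrow> norm (f j t - g j t) \<le> C j" by (rule strategy_difference_bounded) blast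
  have "(\<lambda>s. f j (s j) - g j (s j)) \<in> borel_measurable (belief t)"
    by (intro borel_measurable_belief t
        measurable_compose[OF measurable_others_coordinate[OF j] strategy_difference_measurable[OF f g j]])
  then show ?thesis
    using C[OF f g j] j
    by (intro belief.integrable_const_bound[of _ "C j"])
      (auto simp: space_belief[OF t] others_types_def PiE_iff intro!: AE_I2)
qed

text \<open>The heart of the argument: stability of maximizers for the expected utilities of a fixed own type,
with the Lipschitz constant of their difference obtained by integrating the one of the realized
utilities. The bound averages the distances of the strategies over the belief of that type; both
kinds of norm estimates follow from it.\<close>

lemma optimal_response_interim_estimate:
  assumes f: "f \<in> others_strategies G i" and g: "g \<in> others_strategies G i" and t: "t \<in> types G i"
  shows "norm (optimal_response G i f t - optimal_response G i g t)
    \<le> (\<integral>s. (\<Sum>j\<in>others G i. \<tau> i j / \<sigma> i * norm (f j (s j) - g j (s j))) \<partial>belief t)"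
proof -
  define a c where "a = optimal_response G i f t" and "c = optimal_response G i g t"
  define L where "L = (\<integral>s. (\<Sum>j\<in>others G i. \<tau> i j * norm (f j (s j) - g j (s j))) \<partial>belief t)"
  have a: "a \<in> argmax_on (actions G i) (\<lambda>a. expected_utility G i a f t)"
    and c: "c \<in> argmax_on (actions G i) (\<lambda>a. expected_utility G i a g t)"
    using optimal_responses_eq[OF f t] optimal_responses_eq[OF g t]
    by (auto simp: a_def c_def optimal_responses_eq_argmax)
  then have a_mem: "a \<in> actions G i" and c_mem: "c \<in> actions G i" by (auto simp: argmax_on_def)
  have int_L: "integrable (belief t) (\<lambda>s. \<Sum>j\<in>others G i. \<tau> i j * norm (f j (s j) - g j (s j)))"
    by (intro Bochner_Integration.integrable_sum integrable_mult_right
        strategy_difference_integrable f g t)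
  have L_nn: "0 \<le> L"
    unfolding L_def by (intro integral_nonneg_AE AE_I2 sum_nonneg mult_nonneg_nonneg tau_nonneg) auto
  note int = realized_integrable[OF f a_mem t] realized_integrable[OF g a_mem t]
    realized_integrable[OF f c_mem t] realized_integrable[OF g c_mem t]
  have "(expected_utility G i a f t - expected_utility G i a g t)
      - (expected_utility G i c f t - expected_utility G i c g t)
    = (\<integral>s. (realized f t a s - realized g t a s) - (realized f t c s - realized g t c s) \<partial>belief t)"
    using int by (simp add: expected_utility_eq)
  also have "\<dots> \<le> (\<integral>s. (\<Sum>j\<in>others G i. \<tau> i j * norm (f j (s j) - g j (s j))) * norm (a - c) \<partial>belief t)"
  proof (rule integral_mono)
    fix s assume "s \<in> space (belief t)"
    then have s: "s \<in> others_types G i" by (simp add: space_belief[OF t])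
    show "(realized f t a s - realized g t a s) - (realized f t c s - realized g t c s)
        \<le> (\<Sum>j\<in>others G i. \<tau> i j * norm (f j (s j) - g j (s j))) * norm (a - c)"
      using utility_increment_Lipschitz[OF play_mem_others_actions[OF f s] play_mem_others_actions[OF g s]
          fun_upd_type_profile[OF i s t] a_mem c_mem]
      by (simp add: realized_def play_def)
  qed (use int int_L in auto)
  also have "\<dots> = L * norm (a - c)" by (simp add: L_def)
  finally have "norm (a - c) \<le> L / \<sigma> i"
    using expected_utility_strongly_concave[OF f t] expected_utility_strongly_concave[OF g t]
      actions_props(3)[OF i] sigma_pos L_nn a c
    by (intro argmax_on_strongly_concave_stable) auto
  also have "L / \<sigma> i = (\<integral>s. (\<Sum>j\<in>others G i. \<tau> i j * norm (f j (s j) - g j (s j))) / \<sigma> i \<partial>belief t)"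
    by (simp add: L_def)
  finally show ?thesis by (simp add: a_def c_def sum_divide_distrib)
qed

subsection \<open>The prior law of the types of the others\<close>

lemma measurable_prior_coordinate:
  assumes "j \<in> players G"
  shows "(\<lambda>\<theta>. \<theta> j) \<in> measurable (prior G) (restrict_space borel (types G j))"
proof -
  have "(\<lambda>\<theta>. \<theta> j) \<in> measurable (restrict_space borel (type_profiles G)) (restrict_space borel (types G j))"
    by (intro measurable_restrict_space3) (use assms in \<open>auto simp: type_profiles_def\<close>)
  then show ?thesis using sets_prior by (simp cong: measurable_cong_sets)
qed

lemma measurable_prior_others:
  "(\<lambda>\<theta>. restrict \<theta> (others G i)) \<in> measurable (prior G) other_types"
proof -
  have "(\<lambda>\<theta>::nat \<Rightarrow> 'd. restrict \<theta> (others G i)) \<in> borel_measurable borel"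
  proof (rule measurable_coordinatewise_then_product)
    fix j show "(\<lambda>\<theta>::nat \<Rightarrow> 'd. restrict \<theta> (others G i) j) \<in> borel_measurable borel"
      by (cases "j \<in> others G i") auto
  qed
  then have "(\<lambda>\<theta>. restrict \<theta> (others G i)) \<in> measurable (restrict_space borel (type_profiles G)) other_types"
    by (rule measurable_restrict_space3)
      (auto simp: type_profiles_def others_types_def others_def PiE_iff)
  then show ?thesis using sets_prior by (simp cong: measurable_cong_sets)
qed

lemma space_prior: "space (prior G) = type_profiles G"
  using sets_eq_imp_space_eq[OF sets_prior] by (simp add: space_restrict_space)

lemma marginal_prob: "prob_space (marginal G i)"
  unfolding marginal_def
  by (intro prob_space.prob_space_distr prior_prob measurable_prior_coordinate i)

lemma sets_marginal: "sets (marginal G i) = sets own_types"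
  by (simp add: marginal_def)

text \<open>Disintegration of the prior: drawing the own type and then the types of the others from the belief
produces the prior law of the types of the others.\<close>

lemma marginal_bind_belief:
  "marginal G i \<bind> belief = distr (prior G) other_types (\<lambda>\<theta>. restrict \<theta> (others G i))"
proof -
  interpret marg: prob_space "marginal G i" by (rule marginal_prob)
  have kernel: "belief \<in> measurable (marginal G i) (subprob_algebra other_types)"
    using belief_kernel sets_marginal by (simp cong: measurable_cong_sets)
  have space_marg: "space (marginal G i) = types G i"
    using sets_eq_imp_space_eq[OF sets_marginal] by (simp add: space_restrict_space)
  have sets_bind: "sets (marginal G i \<bind> belief) = sets other_types"
    using marg.not_empty sets_kernel[OF kernel] by (intro sets_bind) auto
  show ?thesis
  proof (rule measure_eqI)
    fix S assume "S \<in> sets (marginal G i \<bind> belief)"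
    then have S: "S \<in> sets other_types" using sets_bind by simp
    have "emeasure (marginal G i \<bind> belief) S = (\<integral>\<^sup>+t. emeasure (belief t) S \<partial>marginal G i)"
      using marg.not_empty kernel S by (rule emeasure_bind)
    also have "\<dots> = (\<integral>\<^sup>+t\<in>types G i. emeasure (belief t) S \<partial>marginal G i)"
      by (intro nn_integral_cong) (simp add: space_marg)
    also have "\<dots> = emeasure (prior G) {\<theta>\<in>type_profiles G. \<theta> i \<in> types G i \<and> restrict \<theta> (others G i) \<in> S}"
    proof -
      have "types G i \<in> sets own_types"
        using sets.top[of own_types] by (simp add: space_restrict_space)
      then show ?thesis using game i S by (simp add: is_bayesian_game_def is_conditional_def)
    qed
    also have "{\<theta>\<in>type_profiles G. \<theta> i \<in> types G i \<and> restrict \<theta> (others G i) \<in> S}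
        = (\<lambda>\<theta>. restrict \<theta> (others G i)) -` S \<inter> space (prior G)"
      using i by (auto simp: space_prior type_profiles_def)
    also have "emeasure (prior G) \<dots> = emeasure (distr (prior G) other_types (\<lambda>\<theta>. restrict \<theta> (others G i))) S"
      using measurable_prior_others S by (simp add: emeasure_distr)
    finally show "emeasure (marginal G i \<bind> belief) S
      = emeasure (distr (prior G) other_types (\<lambda>\<theta>. restrict \<theta> (others G i))) S" .
  qed (simp add: sets_bind)
qed

text \<open>Averaged over the own type, player \<open>j\<close>'s type has its marginal prior law; this is how the beliefs of
player \<open>i\<close> disappear from the right-hand side of the Lipschitz estimate.\<close>

lemma Lp_norm_others_coordinate:
  fixes h :: "'d \<Rightarrow> 'z"
  assumes j: "j \<in> others G i" and h: "h \<in> borel_measurable (restrict_space borel (types G j))"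
  shows "Lp_norm p (marginal G i \<bind> belief) (\<lambda>s. h (s j)) = Lp_norm p (marginal G j) h"
proof -
  have "Lp_norm p (marginal G i \<bind> belief) (\<lambda>s. h (s j)) = Lp_norm p (prior G) (\<lambda>\<theta>. h (\<theta> j))"
    unfolding marginal_bind_belief
    using j measurable_compose[OF measurable_others_coordinate[OF j] h]
    by (subst Lp_norm_distr[OF measurable_prior_others]) auto
  also have "\<dots> = Lp_norm p (marginal G j) h"
    unfolding marginal_def
    using h by (rule Lp_norm_distr[OF measurable_prior_coordinate[OF others_players[OF j]], symmetric])
  finally show ?thesis .
qed

subsection \<open>Lipschitz continuity of the optimal response\<close>

lemma optimal_response_Lp_Lipschitz:
  assumes p: "1 \<le> p" and f: "f \<in> others_strategies G i" and g: "g \<in> others_strategies G i"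
  shows "Lp_norm p (marginal G i) (\<lambda>t. optimal_response G i f t - optimal_response G i g t)
    \<le> (\<Sum>j\<in>others G i. \<tau> i j / \<sigma> i * Lp_norm p (marginal G j) (\<lambda>t. f j t - g j t))"
proof -
  obtain C where C: "\<And>f g j t. f \<in> others_strategies G i \<Longrightarrow> g \<in> others_strategies G i \<Longrightarrow> j \<in> others G i
      \<Longrightarrow> t \<in> types G j \<Longrightarrow> norm (f j t - g j t) \<le> C j" by (rule strategy_difference_bounded) blast
  have space_marg: "space (marginal G i) = types G i"
    using sets_eq_imp_space_eq[OF sets_marginal] by (simp add: space_restrict_space)
  have "Lp_norm p (marginal G i) (\<lambda>t. optimal_response G i f t - optimal_response G i g t)
    \<le> (\<Sum>j\<in>others G i. \<tau> i j / \<sigma> i * Lp_norm p (marginal G i \<bind> belief) (\<lambda>s. f j (s j) - g j (s j)))"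
  proof (rule Lp_norm_kernel_mean_le[where B = C and N = other_types])
    show "belief \<in> measurable (marginal G i) (subprob_algebra other_types)"
      using belief_kernel sets_marginal by (simp cong: measurable_cong_sets)
    show "0 \<le> \<tau> i j / \<sigma> i" if "j \<in> others G i" for j
      using tau_nonneg[OF that] sigma_pos by simp
    show "(\<lambda>s. f j (s j) - g j (s j)) \<in> borel_measurable other_types" if "j \<in> others G i" for j
      by (rule measurable_compose[OF measurable_others_coordinate[OF that]
            strategy_difference_measurable[OF f g that]])
    show "norm (f j (s j) - g j (s j)) \<le> C j" if "j \<in> others G i" "s \<in> space other_types" for j s
      using that by (intro C f g) (auto simp: space_restrict_space others_types_def)
    have "optimal_response G i f \<in> borel_measurable own_types"
      "optimal_response G i g \<in> borel_measurable own_types"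
      using optimal_response_strategy[OF f] optimal_response_strategy[OF g]
      by (simp_all add: strategies_def measurable_restrict_space2_iff)
    then show "(\<lambda>t. optimal_response G i f t - optimal_response G i g t) \<in> borel_measurable (marginal G i)"
      using sets_marginal by (simp cong: measurable_cong_sets)
  qed (use marginal_prob belief_prob finite_others optimal_response_interim_estimate[OF f g] p in
      \<open>simp_all add: space_marg\<close>)
  also have "\<dots> = (\<Sum>j\<in>others G i. \<tau> i j / \<sigma> i * Lp_norm p (marginal G j) (\<lambda>t. f j t - g j t))"
    by (intro sum.cong refl arg_cong2[of _ _ _ _ "(*)"]
        Lp_norm_others_coordinate[of _ "\<lambda>t. f _ t - g _ t"] strategy_difference_measurable f g)
  finally show ?thesis .
qed

lemma optimal_response_sup_Lipschitz:
  assumes f: "f \<in> others_strategies G i" and g: "g \<in> others_strategies G i"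
  shows "sup_norm (types G i) (\<lambda>t. optimal_response G i f t - optimal_response G i g t)
    \<le> (\<Sum>j\<in>others G i. \<tau> i j / \<sigma> i * sup_norm (types G j) (\<lambda>t. f j t - g j t))"
  (is "_ \<le> ?R")
  unfolding sup_norm_def[of "types G i"]
proof (rule cSUP_least[OF types_props(1)[OF i]])
  fix t assume t: "t \<in> types G i"
  interpret belief: prob_space "belief t" by (rule belief_prob[OF t])
  obtain C where C: "\<And>f g j t. f \<in> others_strategies G i \<Longrightarrow> g \<in> others_strategies G i \<Longrightarrow> j \<in> others G i
      \<Longrightarrow> t \<in> types G j \<Longrightarrow> norm (f j t - g j t) \<le> C j" by (rule strategy_difference_bounded) blast
  have "norm (optimal_response G i f t - optimal_response G i g t)
    \<le> (\<integral>s. (\<Sum>j\<in>others G i. \<tau> i j / \<sigma> i * norm (f j (s j) - g j (s j))) \<partial>belief t)"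
    by (rule optimal_response_interim_estimate[OF f g t])
  also have "\<dots> \<le> (\<integral>s. ?R \<partial>belief t)"
  proof (rule integral_mono)
    show "integrable (belief t) (\<lambda>s. \<Sum>j\<in>others G i. \<tau> i j / \<sigma> i * norm (f j (s j) - g j (s j)))"
      by (intro Bochner_Integration.integrable_sum integrable_mult_right
          strategy_difference_integrable f g t)
    fix s assume "s \<in> space (belief t)"
    then have s: "s \<in> others_types G i" by (simp add: space_belief[OF t])
    show "(\<Sum>j\<in>others G i. \<tau> i j / \<sigma> i * norm (f j (s j) - g j (s j))) \<le> ?R"
    proof (intro sum_mono mult_left_mono)
      fix j assume j: "j \<in> others G i"
      show "0 \<le> \<tau> i j / \<sigma> i" using tau_nonneg[OF j] sigma_pos by simp
      have "bdd_above ((\<lambda>t. norm (f j t - g j t)) ` types G j)"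
        using C[OF f g j] by (intro bdd_aboveI2)
      then show "norm (f j (s j) - g j (s j)) \<le> sup_norm (types G j) (\<lambda>t. f j t - g j t)"
        unfolding sup_norm_def using s j
        by (intro cSUP_upper[of "s j" _ "\<lambda>t. norm (f j t - g j t)"]) (auto simp: others_types_def)
    qed
  qed simp
  also have "\<dots> = ?R" by (simp add: belief.prob_space)
  finally show "norm (optimal_response G i f t - optimal_response G i g t) \<le> ?R" .
qed

end

theorem theorem3p1:
  fixes G :: "('d::euclidean_space, 'z::euclidean_space) bayesian_game"
    and grad :: "nat \<Rightarrow> (nat \<Rightarrow> 'z) \<Rightarrow> (nat \<Rightarrow> 'd) \<Rightarrow> 'z"
    and \<sigma> :: "nat \<Rightarrow> real" and \<tau> :: "nat \<Rightarrow> nat \<Rightarrow> real" and i :: nat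
  assumes "is_bayesian_game G"
    and "assumption_A G grad"
    and "assumption_B G grad \<sigma> \<tau>"
    and "i \<in> players G"
  shows "(\<forall>f\<in>others_strategies G i.
            (\<forall>t\<in>types G i. optimal_responses G i f t = {optimal_response G i f t}) \<and>
            optimal_response G i f \<in> strategies G i) \<and>
         (\<forall>p\<ge>1. \<forall>f\<in>others_strategies G i. \<forall>g\<in>others_strategies G i.
            Lp_norm p (marginal G i)
                (\<lambda>t. optimal_response G i f t - optimal_response G i g t)
              \<le> (\<Sum>j\<in>others G i. \<tau> i j / \<sigma> i * Lp_norm p (marginal G j) (\<lambda>t. f j t - g j t))) \<and>
         (\<forall>f\<in>others_strategies G i. \<forall>g\<in>others_strategies G i.
            sup_norm (types G i)
                (\<lambda>t. optimal_response G i f t - optimal_response G i g t)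
              \<le> (\<Sum>j\<in>others G i. \<tau> i j / \<sigma> i * sup_norm (types G j) (\<lambda>t. f j t - g j t)))"
proof -
  interpret bayesian_game_player G grad \<sigma> \<tau> i
    using assms by unfold_locales
  show ?thesis
    by (intro conjI ballI allI impI optimal_responses_eq optimal_response_strategy
        optimal_response_Lp_Lipschitz optimal_response_sup_Lipschitz)
qed

end
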